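(* Let $\Phi=(A;\{E_i\}_{i=0}^d;A^*;\{E_i^*\}_{i=0}^d)$ be a tridiagonal system of diameter $d\geq 1$ on $V$ over $\mathbb{K}$, with base $\beta$, and let $\Delta,\Psi\in\mathrm{End}(V)$ and the scalars $\vartheta_i$ be attached to $\Phi$ as defined in the context. Assume that one of the following holds: (i) $\beta\ne\pm2$; (ii) $\beta=2$ and $\mathrm{Char}(\mathbb{K})\ne2$; (iv) $\beta=-2$, $\mathrm{Char}(\mathbb{K})\neq2$ and $d$ is even (so that the scalars $\vartheta_1,\dots,\vartheta_d$ are nonzero). Then both $$\Delta = I +\frac{\eta_{1}(\theta_0)}{\vartheta_1}\Psi + \frac{\eta_{2}(\theta_0)}{\vartheta_1\vartheta_2}\Psi^2 +\cdots + \frac{\eta_{d}(\theta_0)}{\vartheta_1\vartheta_2 \cdots \vartheta_d} \Psi^d,$$ $$\Delta^{-1} = I +\frac{\tau_{1}(\theta_d)}{\vartheta_1}\Psi + \frac{\tau_{2}(\theta_d)}{\vartheta_1\vartheta_2}\Psi^2 +\cdots+ \frac{\tau_{d}(\theta_d)}{\vartheta_1\vartheta_2 \cdots \vartheta_d} \Psi^d,$$ where $\tau_j=(x-\theta_0)(x-\theta_1)\cdots(x-\theta_{j-1})$ and $\eta_j=(x-\theta_d)(x-\theta_{d-1})\cdots(x-\theta_{d-j+1})$.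
   Context: $\mathbb{K}$ is a field, $V$ is a $\mathbb{K}$-vector space of finite positive dimension, $\mathrm{End}(V)$ is the algebra of linear maps $V\to V$, and $I$ is the identity. A tridiagonal pair (TD pair) on $V$ is an ordered pair $A,A^*\in\mathrm{End}(V)$ ($A^*$ is just a name, not an adjoint) such that: (i) $A$ and $A^*$ are each diagonalizable over $\mathbb{K}$; (ii) there is an ordering $\{V_i\}_{i=0}^d$ of the eigenspaces of $A$ with $A^*V_i\subseteq V_{i-1}+V_i+V_{i+1}$ for $0\le i\le d$, where $V_{-1}=V_{d+1}=0$; (iii) there is an ordering $\{V_i^*\}_{i=0}^{\delta}$ of the eigenspaces of $A^*$ with $AV_i^*\subseteq V_{i-1}^*+V_i^*+V_{i+1}^*$ for $0\le i\le\delta$, where $V_{-1}^*=V_{\delta+1}^*=0$; (iv) there is no subspace $W$ of $V$ with $AW\subseteq W$, $A^*W\subseteq W$, $W\ne0$, $W\ne V$. It is known that $d=\delta$; this is the diameter, and it is assumed that $d\ge1$. Orderings satisfying (ii) (resp. (iii)) are called standard. The primitive idempotent of a diagonalizable map associated with one of its eigenspaces is the projection of $V$ onto that eigenspace that kills the other eigenspaces. A tridiagonal system (TD system) on $V$ is a sequence $\Phi=(A;\{E_i\}_{i=0}^d;A^*;\{E_i^*\}_{i=0}^d)$ where $A,A^*$ is a TD pair on $V$, $\{E_i\}_{i=0}^d$ is an ordering of the primitive idempotents of $A$ such that $\{E_iV\}_{i=0}^d$ is standard, and $\{E_i^*\}_{i=0}^d$ is an ordering of the primitive idempotents of $A^*$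 such that $\{E_i^*V\}_{i=0}^d$ is standard. Let $\theta_i$ (resp. $\theta_i^*$) be the eigenvalue of $A$ on $E_iV$ (resp. of $A^*$ on $E_i^*V$). Base: it is known that the expressions $\frac{\theta_{i-2}-\theta_{i+1}}{\theta_{i-1}-\theta_i}$ and $\frac{\theta^*_{i-2}-\theta^*_{i+1}}{\theta^*_{i-1}-\theta^*_i}$ are equal and independent of $i$ for $2\le i\le d-1$. If $d\ge3$, the base $\beta\in\mathbb{K}$ is defined by letting $\beta+1$ be this common value; if $d\le2$, $\beta$ is any nonzero scalar in $\mathbb{K}$. For $0\le i\le d$ set $U_i=(E_0^*V+\cdots+E_i^*V)\cap(E_iV+\cdots+E_dV)$ and $U_i^{\Downarrow}=(E_0^*V+\cdots+E_i^*V)\cap(E_0V+\cdots+E_{d-i}V)$. It is known that $V=\bigoplus_{i=0}^dU_i=\bigoplus_{i=0}^dU_i^{\Downarrow}$ (first and second split decompositions). Let $F_i$ be the projection of $V$ onto $U_i$ along $\bigoplus_{j\ne i}U_j$, and $F_i^{\Downarrow}$ the projection of $V$ onto $U_i^{\Downarrow}$ along $\bigoplus_{j\ne i}U_j^{\Downarrow}$. Define $\Delta=\sum_{h=0}^dF_h^{\Downarrow}F_h$; it is invertible. For $0\le i\le d/2$ set $K_i=(E_0^*V+\cdots+E_i^*V)\cap(E_iV+E_{i+1}V+\cdots+E_{d-i}V)$. For $0\le i\le j\le d+1$ set $\tau_{ij}=(x-\theta_i)(x-\theta_{i+1})\cdots(x-\theta_{j-1})\in\mathbb{K}[x]$, with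 $\tau_{ii}=1$ and $\tau_{i,i-1}=0$. For $0\le i\le d+1$ set $\vartheta_i=\sum_{h=0}^{i-1}\frac{\theta_h-\theta_{d-h}}{\theta_0-\theta_d}$. It is known that $V=\bigoplus_{0\le i\le d/2}\bigoplus_{j=i}^{d-i}\tau_{ij}(A)K_i$. $\Psi$ is the unique element of $\mathrm{End}(V)$ such that $\Psi\tau_{ij}(A)v=(\vartheta_j-\vartheta_i)\tau_{i,j-1}(A)v$ for all $0\le i\le d/2$, $i\le j\le d-i$, $v\in K_i$. *)

theory Defs
  imports "HOL-Computational_Algebra.Polynomial" "HOL-Library.Set_Algebras"
begin

(* V is the whole type 'v, and End(V) consists of the functions f with
   Vector_Spaces.linear scale scale f.  Sums of subspaces are sums of sets in
   the sense of Set_Algebras; in particular 0 :: 'v set is {0}, and the empty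
   sum of subspaces is the zero subspace. *)

(* A copy of vector_space, so that the definitions below are not inherited by the
   library's interpretations of vector_space (such as real_vector). *)
locale td_space = vector_space scale
  for scale :: "'a::field \<Rightarrow> 'b::ab_group_add \<Rightarrow> 'b" (infixr \<open>*s\<close> 75)
begin

definition eigenspace :: "('b \<Rightarrow> 'b) \<Rightarrow> 'a \<Rightarrow> 'b set" where
  "eigenspace A t = {v. A v = t *s v}"

definition eigenspaces :: "('b \<Rightarrow> 'b) \<Rightarrow> 'b set set" where
  "eigenspaces A = {W. \<exists>t. W = eigenspace A t \<and> W \<noteq> {0}}"

definition diagonalizable :: "('b \<Rightarrow> 'b) \<Rightarrow> bool" where
  "diagonalizable A \<longleftrightarrow>
     (\<exists>B. independent B \<and> span B = UNIV \<and> (\<forall>b\<in>B. \<exists>t. A b = t *s b))"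

definition standard_ordering ::
    "('b \<Rightarrow> 'b) \<Rightarrow> ('b \<Rightarrow> 'b) \<Rightarrow> nat \<Rightarrow> (nat \<Rightarrow> 'b set) \<Rightarrow> bool" where
  "standard_ordering A As d W \<longleftrightarrow>
     bij_betw W {0..d} (eigenspaces A) \<and>
     (\<forall>i\<le>d. As ` W i \<subseteq>
        (if i = 0 then 0 else W (i - 1)) + W i + (if i = d then 0 else W (i + 1)))"

definition td_pair :: "('b \<Rightarrow> 'b) \<Rightarrow> ('b \<Rightarrow> 'b) \<Rightarrow> bool" where
  "td_pair A As \<longleftrightarrow>
     Vector_Spaces.linear scale scale A \<and> Vector_Spaces.linear scale scale As \<and>
     diagonalizable A \<and> diagonalizable As \<and>
     (\<exists>d W. standard_ordering A As d W) \<and>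
     (\<exists>\<delta> W. standard_ordering As A \<delta> W) \<and>
     \<not> (\<exists>W. subspace W \<and> A ` W \<subseteq> W \<and> As ` W \<subseteq> W \<and> W \<noteq> {0} \<and> W \<noteq> UNIV)"

definition primitive_idempotents :: "('b \<Rightarrow> 'b) \<Rightarrow> ('b \<Rightarrow> 'b) set" where
  "primitive_idempotents A =
     {P. Vector_Spaces.linear scale scale P \<and>
         (\<exists>W\<in>eigenspaces A. (\<forall>v\<in>W. P v = v) \<and>
            (\<forall>W'\<in>eigenspaces A. W' \<noteq> W \<longrightarrow> (\<forall>v\<in>W'. P v = 0)))}"

(* Sequences indexed by 0..d are functions on nat whose values beyond d are irrelevant. *)
definition td_system ::
    "nat \<Rightarrow> ('b \<Rightarrow> 'b) \<Rightarrow> (nat \<Rightarrow> 'b \<Rightarrow> 'b) \<Rightarrow> ('b \<Rightarrow> 'b) \<Rightarrow> (nat \<Rightarrow> 'b \<Rightarrow> 'b) \<Rightarrow> bool" where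
  "td_system d A E As Es \<longleftrightarrow>
     td_pair A As \<and>
     bij_betw E {0..d} (primitive_idempotents A) \<and>
     standard_ordering A As d (\<lambda>i. range (E i)) \<and>
     bij_betw Es {0..d} (primitive_idempotents As) \<and>
     standard_ordering As A d (\<lambda>i. range (Es i))"

definition eigenvalue :: "('b \<Rightarrow> 'b) \<Rightarrow> (nat \<Rightarrow> 'b \<Rightarrow> 'b) \<Rightarrow> nat \<Rightarrow> 'a" where
  "eigenvalue A E i = (THE t. \<forall>v\<in>range (E i). A v = t *s v)"

definition split_U ::
    "nat \<Rightarrow> (nat \<Rightarrow> 'b \<Rightarrow> 'b) \<Rightarrow> (nat \<Rightarrow> 'b \<Rightarrow> 'b) \<Rightarrow> nat \<Rightarrow> 'b set" where
  "split_U d E Es i = (\<Sum>h=0..i. range (Es h)) \<inter> (\<Sum>h=i..d. range (E h))"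

definition split_U_down ::
    "nat \<Rightarrow> (nat \<Rightarrow> 'b \<Rightarrow> 'b) \<Rightarrow> (nat \<Rightarrow> 'b \<Rightarrow> 'b) \<Rightarrow> nat \<Rightarrow> 'b set" where
  "split_U_down d E Es i = (\<Sum>h=0..i. range (Es h)) \<inter> (\<Sum>h=0..d - i. range (E h))"

definition split_projection :: "nat \<Rightarrow> (nat \<Rightarrow> 'b set) \<Rightarrow> nat \<Rightarrow> 'b \<Rightarrow> 'b" where
  "split_projection d U i = (THE P. Vector_Spaces.linear scale scale P \<and>
     (\<forall>v\<in>U i. P v = v) \<and> (\<forall>j\<le>d. j \<noteq> i \<longrightarrow> (\<forall>v\<in>U j. P v = 0)))"

definition Delta ::
    "nat \<Rightarrow> (nat \<Rightarrow> 'b \<Rightarrow> 'b) \<Rightarrow> (nat \<Rightarrow> 'b \<Rightarrow> 'b) \<Rightarrow> 'b \<Rightarrow> 'b" where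
  "Delta d E Es v =
     (\<Sum>h=0..d. split_projection d (split_U_down d E Es) h
                 (split_projection d (split_U d E Es) h v))"

definition K_space ::
    "nat \<Rightarrow> (nat \<Rightarrow> 'b \<Rightarrow> 'b) \<Rightarrow> (nat \<Rightarrow> 'b \<Rightarrow> 'b) \<Rightarrow> nat \<Rightarrow> 'b set" where
  "K_space d E Es i = (\<Sum>h=0..i. range (Es h)) \<inter> (\<Sum>h=i..d - i. range (E h))"

definition poly_apply :: "'a poly \<Rightarrow> ('b \<Rightarrow> 'b) \<Rightarrow> 'b \<Rightarrow> 'b" where
  "poly_apply p A v = (\<Sum>n=0..degree p. coeff p n *s (A ^^ n) v)"

end

definition tau :: "(nat \<Rightarrow> 'k::field) \<Rightarrow> nat \<Rightarrow> nat \<Rightarrow> 'k poly" where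
  "tau \<theta> i j = (if j < i then 0 else (\<Prod>h\<in>{i..<j}. [:- \<theta> h, 1:]))"

definition eta :: "nat \<Rightarrow> (nat \<Rightarrow> 'k::field) \<Rightarrow> nat \<Rightarrow> 'k poly" where
  "eta d \<theta> j = (\<Prod>h\<in>{0..<j}. [:- \<theta> (d - h), 1:])"

definition vartheta :: "nat \<Rightarrow> (nat \<Rightarrow> 'k::field) \<Rightarrow> nat \<Rightarrow> 'k" where
  "vartheta d \<theta> i = (\<Sum>h\<in>{0..<i}. (\<theta> h - \<theta> (d - h)) / (\<theta> 0 - \<theta> d))"

(* A predicate rather than a function, because for d \<le> 2 the base is an
   arbitrary nonzero scalar. *)
definition is_base :: "nat \<Rightarrow> (nat \<Rightarrow> 'k::field) \<Rightarrow> (nat \<Rightarrow> 'k) \<Rightarrow> 'k \<Rightarrow> bool" where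
  "is_base d \<theta> \<theta>s \<beta> \<longleftrightarrow>
     (if d \<ge> 3 then
        \<forall>i\<in>{2..d - 1}.
          (\<theta> (i - 2) - \<theta> (i + 1)) / (\<theta> (i - 1) - \<theta> i) = \<beta> + 1 \<and>
          (\<theta>s (i - 2) - \<theta>s (i + 1)) / (\<theta>s (i - 1) - \<theta>s i) = \<beta> + 1
      else \<beta> \<noteq> 0)"

context td_space
begin

(* For j = i the scalar on the right is zero, so truncation in j - 1 when
   i = j = 0 does no harm. *)
definition Psi ::
    "nat \<Rightarrow> ('b \<Rightarrow> 'b) \<Rightarrow> (nat \<Rightarrow> 'b \<Rightarrow> 'b) \<Rightarrow> (nat \<Rightarrow> 'b \<Rightarrow> 'b) \<Rightarrow> 'b \<Rightarrow> 'b" where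
  "Psi d A E Es =
     (let \<theta> = eigenvalue A E in
      THE P. Vector_Spaces.linear scale scale P \<and>
        (\<forall>i j. 2 * i \<le> d \<longrightarrow> i \<le> j \<longrightarrow> j \<le> d - i \<longrightarrow>
          (\<forall>v\<in>K_space d E Es i.
             P (poly_apply (tau \<theta> i j) A v) =
             (vartheta d \<theta> j - vartheta d \<theta> i) *s poly_apply (tau \<theta> i (j - 1)) A v)))"

end

end

theory Submission
  imports Defs
begin

text \<open>
Let \<open>v\<close> lie in \<open>K i\<close> and let \<open>\<tau>\<^bsub>ij\<^esub>\<close> and \<open>\<eta>\<^bsub>ij\<^esub>\<close> be the products of the \<open>x - \<theta>\<^sub>h\<close> and of the \<open>x - \<theta>\<^bsub>d-h\<^esub>\<close> for
\<open>i \<le> h < j\<close>. The vectors \<open>\<tau>\<^bsub>ij\<^esub>(A) v\<close> and \<open>\<eta>\<^bsub>ij\<^esub>(A) v\<close> lie in the \<open>j\<close>-th components of the first and of the second split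
decomposition, and they agree modulo the first \<open>j\<close> eigenspaces of the dual map. As the second split
projection kills those eigenspaces, \<Delta> maps \<open>\<tau>\<^bsub>ij\<^esub>(A) v\<close> to \<open>\<eta>\<^bsub>ij\<^esub>(A) v\<close> (\<open>Delta_ladder\<close>), while \<Psi> lowers
\<open>\<tau>\<^bsub>ij\<^esub>(A) v\<close> to a multiple of \<open>\<tau>\<^bsub>i,j-1\<^esub>(A) v\<close>. So the expansion of \<Delta> is a statement about expressing one Newton
basis of polynomials in another (\<open>tau_change_of_base\<close>). By induction on \<open>j\<close> it reduces to a single identity
between the scalars \<open>\<theta>\<close> and \<open>\<vartheta>\<close> (\<open>vartheta_increment_ratio\<close>). Up to constant
factors both sides of that identity are, as functions of one index \<open>i\<close>, homogeneous solutions of the same three-term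
recurrence of the form \<open>g i - g (N - i)\<close>, and such solutions are proportional.

The expansion shows that \<Delta> commutes with \<Psi>. Therefore \<Psi> lowers the \<open>\<eta>\<^bsub>ij\<^esub>(A) v\<close> in the same way, and the
argument applied to the reversed eigenvalue ordering, under which \<vartheta> is invariant, expresses
\<open>\<tau>\<^bsub>ij\<^esub>(A) v\<close> through \<open>\<eta>\<^bsub>ij\<^esub>(A) v\<close>. This gives the inverse of \<Delta>.

These arguments need the vectors \<open>\<tau>\<^bsub>ij\<^esub>(A) v\<close> to span the space, and they must form a direct sum for \<Psi> to exist.
Irreducibility makes opposite flags of eigenspaces intersect trivially (\<open>F_meet_G\<close>), which gives the split
decompositions. It also makes the products of the \<open>A - \<theta>\<^sub>h\<close> from \<open>U\<^sub>i\<close> to \<open>U\<^bsub>d-i\<^esub>\<close>, and the products of the dual factors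
in the opposite direction, injective; by finite dimension both are bijective. The kernel of one
further factor on \<open>U\<^sub>i\<close> is \<open>K\<^sub>i\<close>, so \<open>U\<^sub>i\<close> is the direct sum of \<open>K\<^sub>i\<close> and the raised image of \<open>U\<^bsub>i-1\<^esub>\<close>, and the
decomposition follows by induction (\<open>span_ladder\<close>, \<open>ladder_independent\<close>).
\<close>

section \<open>Scalars of a sequence with a three-term recurrence\<close>

text \<open>Eigenvalue sequences with base \<beta> satisfy this three-term recurrence for some \<gamma>. For \<open>N \<le> 2\<close> every
sequence does, with any \<beta>, so the arbitrary base of a system of small diameter is covered too.\<close>
definition recurrent :: "'k::field \<Rightarrow> 'k \<Rightarrow> nat \<Rightarrow> (nat \<Rightarrow> 'k) \<Rightarrow> bool" where
  "recurrent \<beta> \<gamma> N y \<longleftrightarrow> (\<forall>i. i + 2 \<le> N \<longrightarrow> y i + y (i + 2) = \<beta> * y (i + 1) + \<gamma>)"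

lemma recurrent_zero_everywhere:
  assumes rec: "recurrent \<beta> 0 N y" and p: "p + 1 \<le> N" "y p = 0" "y (p + 1) = 0"
    and i: "i \<le> N"
  shows "y i = 0"
proof -
  have up: "y (p + n) = 0 \<and> y (p + n + 1) = 0" if "p + n + 1 \<le> N" for n
    using that
  proof (induction n)
    case 0
    then show ?case using p by simp
  next
    case (Suc n)
    have "y (p + n) + y (p + n + 2) = \<beta> * y (p + n + 1) + 0"
      using rec Suc.prems unfolding recurrent_def by auto
    moreover have "y (p + n) = 0" "y (p + n + 1) = 0"
      using Suc by auto
    ultimately show ?case by simp
  qed
  have down: "y (p - n) = 0 \<and> y (p - n + 1) = 0" for n
  proof (induction n)
    case 0
    then show ?case using p by simp
  next
    case (Suc n)
    show ?case
    proof (cases "n < p")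
      case True
      then obtain m where m: "p - n = Suc m" "p - Suc n = m"
        by (metis Suc_diff_Suc)
      have "y m + y (m + 2) = \<beta> * y (m + 1) + 0"
        using rec m p(1) unfolding recurrent_def by auto
      then show ?thesis using Suc m by simp
    next
      case False
      then show ?thesis using Suc by simp
    qed
  qed
  show ?thesis
  proof (cases "i \<le> p")
    case True
    then show ?thesis using down[of "p - i"] by simp
  next
    case False
    then have "i = p + (i - p - 1) + 1" by simp
    then show ?thesis using up[of "i - p - 1"] i by auto
  qed
qed

text \<open>Subtracting the mirror image removes the constant \<gamma> and gives a solution of the homogeneous
recurrence that is odd under reflection. The form \<open>g i - g (N - i)\<close>, rather than oddness alone,
makes the middle term of an even interval vanish in characteristic 2 as well.\<close>
lemma recurrent_minus_reflection:
  assumes "recurrent \<beta> \<gamma> N g"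
  shows "recurrent \<beta> 0 N (\<lambda>i. g i - g (N - i))"
  unfolding recurrent_def
proof (intro allI impI)
  fix i assume i: "i + 2 \<le> N"
  define m where "m = N - i - 2"
  have m: "N - i = m + 2" "N - (i + 1) = m + 1" "N - (i + 2) = m" "m + 2 \<le> N"
    using i by (auto simp: m_def)
  have "g i + g (i + 2) = \<beta> * g (i + 1) + \<gamma>" "g m + g (m + 2) = \<beta> * g (m + 1) + \<gamma>"
    using assms i m unfolding recurrent_def by auto
  then show "g i - g (N - i) + (g (i + 2) - g (N - (i + 2)))
      = \<beta> * (g (i + 1) - g (N - (i + 1))) + 0"
    unfolding m by (simp add: algebra_simps)
qed

text \<open>Homogeneous solutions of the form \<open>g i - g (N - i)\<close> are determined up to a factor. The reason is the
Casoratian \<open>y i * z (i + 1) - y (i + 1) * z i\<close>, which does not depend on \<open>i\<close> and vanishes at the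
centre of the interval.\<close>
lemma reflection_differences_proportional:
  fixes g g' :: "nat \<Rightarrow> 'k::field"
  defines "y \<equiv> \<lambda>N i. g i - g (N - i)" and "z \<equiv> \<lambda>N i. g' i - g' (N - i)"
  assumes g: "recurrent \<beta> \<gamma> N g" and g': "recurrent \<beta> \<gamma>' N g'" and i: "i \<le> N"
  shows "y N i * z N 0 = y N 0 * z N i"
proof (cases "N = 0")
  case True
  then show ?thesis using i by simp
next
  case False
  define W where "W i = y N i * z N (i + 1) - y N (i + 1) * z N i" for i
  have hy: "recurrent \<beta> 0 N (y N)" and hz: "recurrent \<beta> 0 N (z N)"
    using recurrent_minus_reflection[OF g] recurrent_minus_reflection[OF g']
    by (simp_all add: y_def z_def)
  have W0: "W n = W 0" if "n + 1 \<le> N" for n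
    using that
  proof (induction n)
    case (Suc n)
    have 1: "y N (n + 2) = \<beta> * y N (n + 1) - y N n"
      using hy Suc.prems unfolding recurrent_def by (auto simp: eq_diff_eq add.commute)
    have 2: "z N (n + 2) = \<beta> * z N (n + 1) - z N n"
      using hz Suc.prems unfolding recurrent_def by (auto simp: eq_diff_eq add.commute)
    have "Suc n + 1 = n + 2" by simp
    then have "W (Suc n) = W n"
      unfolding W_def Suc_eq_plus1 by (simp only: 1 2) (simp add: algebra_simps)
    then show ?case using Suc by simp
  qed simp
  have "W 0 = 0"
  proof (cases "even N")
    case True
    then obtain m where m: "N = 2 * m" by blast
    then have "N - m = m" by simp
    then have "W m = 0" by (simp add: W_def y_def z_def)
    then show ?thesis using W0[of m] m False by simp
  next
    case odd: False
    then obtain m where m: "N = 2 * m + 1" by (rule oddE)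
    then have "N - m = m + 1" "N - (m + 1) = m" by simp_all
    then have "W m = 0" by (simp add: W_def y_def z_def algebra_simps)
    then show ?thesis using W0[of m] m by simp
  qed
  moreover have "recurrent \<beta> 0 N (\<lambda>i. y N i * z N 0 - y N 0 * z N i)"
    unfolding recurrent_def
  proof (intro allI impI)
    fix i assume i: "i + 2 \<le> N"
    have "y N (i + 2) = \<beta> * y N (i + 1) - y N i" "z N (i + 2) = \<beta> * z N (i + 1) - z N i"
      using hy hz i unfolding recurrent_def by (auto simp: eq_diff_eq add.commute)
    then show "y N i * z N 0 - y N 0 * z N i + (y N (i + 2) * z N 0 - y N 0 * z N (i + 2))
        = \<beta> * (y N (i + 1) * z N 0 - y N 0 * z N (i + 1)) + 0"
      by (simp only:) (simp add: algebra_simps)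
  qed
  ultimately have "y N i * z N 0 - y N 0 * z N i = 0"
    using recurrent_zero_everywhere[of \<beta> N "\<lambda>i. y N i * z N 0 - y N 0 * z N i" 0 i] i False
    by (simp add: W_def)
  then show ?thesis by simp
qed

lemma vartheta_diff:
  "vartheta d \<theta> (i + l) - vartheta d \<theta> i
     = (\<Sum>h<l. \<theta> (i + h) - \<theta> (d - (i + h))) / (\<theta> 0 - \<theta> d)"
proof -
  have "(\<Sum>h\<in>{0..<i+l}. (\<theta> h - \<theta> (d - h)) / (\<theta> 0 - \<theta> d))
     = (\<Sum>h\<in>{0..<i}. (\<theta> h - \<theta> (d - h)) / (\<theta> 0 - \<theta> d))
     + (\<Sum>h\<in>{i..<i+l}. (\<theta> h - \<theta> (d - h)) / (\<theta> 0 - \<theta> d))"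
    by (simp add: sum.atLeastLessThan_concat)
  moreover have "(\<Sum>h\<in>{i..<i+l}. (\<theta> h - \<theta> (d - h)) / (\<theta> 0 - \<theta> d))
     = (\<Sum>h<l. (\<theta> (i + h) - \<theta> (d - (i + h))) / (\<theta> 0 - \<theta> d))"
    using sum.shift_bounds_nat_ivl[of "\<lambda>h. (\<theta> h - \<theta> (d - h)) / (\<theta> 0 - \<theta> d)" 0 i l]
    by (simp add: add.commute lessThan_atLeast0)
  ultimately show ?thesis
    by (simp add: vartheta_def sum_divide_distrib)
qed

lemma vartheta_0 [simp]: "vartheta d \<theta> 0 = 0"
  by (simp add: vartheta_def)

text \<open>The one scalar identity behind both expansions. For fixed \<open>l\<close> the increment of \<vartheta> over \<open>l\<close> steps from \<open>i\<close>
is a difference \<open>P i - P (N - i)\<close> of window sums of \<theta>, where \<open>N = d + 1 - l\<close>; it is therefore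
proportional, as a function of \<open>i\<close>, to \<open>\<theta> i - \<theta> (N - i)\<close>.\<close>
lemma vartheta_increment_ratio:
  assumes rec: "recurrent \<beta> \<gamma> d \<theta>" and l: "1 \<le> l" and il: "i + l \<le> d + 1"
  shows "(\<theta> 0 - \<theta> (d + 1 - l)) * (vartheta d \<theta> (i + l) - vartheta d \<theta> i)
       = (\<theta> i - \<theta> (d + 1 - l - i)) * vartheta d \<theta> l"
proof -
  define N where "N = d + 1 - l"
  define P where "P i = (\<Sum>h<l. \<theta> (i + h))" for i
  have recN: "recurrent \<beta> \<gamma> N \<theta>"
    using rec l by (auto simp: recurrent_def N_def)
  have recP: "recurrent \<beta> (of_nat l * \<gamma>) N P"
    unfolding recurrent_def
  proof (intro allI impI)
    fix i assume i: "i + 2 \<le> N"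
    have "\<theta> (i + h) + \<theta> (i + 2 + h) = \<beta> * \<theta> (i + 1 + h) + \<gamma>" if "h < l" for h
    proof -
      have "i + h + 2 \<le> d" using that i by (auto simp: N_def)
      then have "\<theta> (i + h) + \<theta> (i + h + 2) = \<beta> * \<theta> (i + h + 1) + \<gamma>"
        using rec unfolding recurrent_def by blast
      then show ?thesis by (simp add: add_ac)
    qed
    then have "(\<Sum>h<l. \<theta> (i + h) + \<theta> (i + 2 + h)) = (\<Sum>h<l. \<beta> * \<theta> (i + 1 + h) + \<gamma>)"
      by simp
    then show "P i + P (i + 2) = \<beta> * P (i + 1) + of_nat l * \<gamma>"
      unfolding P_def by (simp add: sum.distrib sum_distrib_left)
  qed
  have S: "(\<Sum>h<l. \<theta> (i + h) - \<theta> (d - (i + h))) = P i - P (N - i)" if "i \<le> N" for i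
  proof -
    have "P (N - i) = (\<Sum>h<l. \<theta> (N - i + (l - Suc h)))"
      unfolding P_def by (rule sum.nat_diff_reindex[symmetric])
    also have "\<dots> = (\<Sum>h<l. \<theta> (d - (i + h)))"
    proof (rule sum.cong)
      fix h assume "h \<in> {..<l}"
      then have "N - i + (l - Suc h) = d - (i + h)"
        using that il unfolding N_def by auto
      then show "\<theta> (N - i + (l - Suc h)) = \<theta> (d - (i + h))" by simp
    qed simp
    finally show ?thesis by (simp add: P_def sum_subtractf)
  qed
  have iN: "i \<le> N" using il by (simp add: N_def)
  have "(\<theta> i - \<theta> (N - i)) * (P 0 - P (N - 0)) = (\<theta> 0 - \<theta> (N - 0)) * (P i - P (N - i))"
    by (rule reflection_differences_proportional[OF recN recP iN])
  then have "(\<theta> 0 - \<theta> N) * ((P i - P (N - i)) / (\<theta> 0 - \<theta> d))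
      = (\<theta> i - \<theta> (N - i)) * ((P 0 - P (N - 0)) / (\<theta> 0 - \<theta> d))"
    by simp
  then show ?thesis
    using vartheta_diff[of d \<theta> i l] vartheta_diff[of d \<theta> 0 l] S[OF iN] S[of 0]
    by (simp add: N_def)
qed

text \<open>If \<open>\<vartheta>\<^sub>l = 0\<close>, then \<open>\<vartheta>\<^bsub>l+1\<^esub> = \<vartheta>\<^sub>1\<close> as well, so \<open>f i = \<theta> i - \<theta> (d - i)\<close> and its shift both have sum zero over
the first \<open>l\<close> indices. When \<open>f\<close> and its shift span the homogeneous solutions, the differences
\<open>\<theta> i - \<theta> (i + 1)\<close> are a combination of them, and telescoping gives the contradiction \<open>\<theta>\<^sub>0 = \<theta>\<^sub>l\<close>. The
hypothesis on \<open>d\<close> and \<beta> is what makes them span: at the centre \<open>m\<close> of an interval with \<open>d = 2 * m + 1\<close> the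
determinant of \<open>f\<close> and its shift is \<open>- (\<beta> + 2) * (f m)\<^sup>2\<close>.\<close>
lemma vartheta_nonzero:
  fixes \<theta> :: "nat \<Rightarrow> 'k::field"
  assumes rec: "recurrent \<beta> \<gamma> d \<theta>" and inj: "inj_on \<theta> {0..d}"
    and \<beta>: "even d \<or> \<beta> \<noteq> -2" and l: "1 \<le> l" "l \<le> d"
  shows "vartheta d \<theta> l \<noteq> 0"
proof
  assume zero: "vartheta d \<theta> l = 0"
  have neq: "\<theta> i \<noteq> \<theta> j" if "i \<le> d" "j \<le> d" "i \<noteq> j" for i j
    using inj that by (auto simp: inj_on_def)
  define f where "f i = \<theta> i - \<theta> (d - i)" for i
  define \<delta> where "\<delta> i = \<theta> i - \<theta> (i + 1)" for i
  have frec: "recurrent \<beta> 0 d f"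
    using recurrent_minus_reflection[OF rec] by (simp add: f_def[abs_def])
  have l1: "l \<noteq> 1"
  proof
    assume "l = 1"
    then have "vartheta d \<theta> l = 1"
      using neq[of 0 d] l by (simp add: vartheta_def)
    then show False using zero by simp
  qed
  have period: "vartheta d \<theta> (1 + l) = vartheta d \<theta> 1"
  proof -
    have "(\<theta> 0 - \<theta> (d + 1 - l)) * (vartheta d \<theta> (1 + l) - vartheta d \<theta> 1) = 0"
      using vartheta_increment_ratio[OF rec l(1), of 1] l zero by simp
    moreover have "\<theta> 0 \<noteq> \<theta> (d + 1 - l)"
      using l by (intro neq) auto
    ultimately show ?thesis by simp
  qed
  have S0: "(\<Sum>h<l. f h) = 0" and S1: "(\<Sum>h<l. f (h + 1)) = 0"
    using vartheta_diff[of d \<theta> 0 l] vartheta_diff[of d \<theta> 1 l] zero period neq[of 0 d] l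
    by (auto simp: f_def)
  have \<delta>rec: "recurrent \<beta> 0 (d - 1) \<delta>"
    unfolding recurrent_def
  proof (intro allI impI)
    fix i assume i: "i + 2 \<le> d - 1"
    have "i + 1 + 2 \<le> d" "i + 2 \<le> d" using i by auto
    then have "\<theta> i + \<theta> (i + 2) = \<beta> * \<theta> (i + 1) + \<gamma>"
      "\<theta> (i + 1) + \<theta> (i + 1 + 2) = \<beta> * \<theta> (i + 1 + 1) + \<gamma>"
      using rec unfolding recurrent_def by blast+
    then show "\<delta> i + \<delta> (i + 2) = \<beta> * \<delta> (i + 1) + 0"
      by (simp add: \<delta>_def algebra_simps numeral_eq_Suc)
  qed
  obtain p a b where p: "p + 1 \<le> d - 1"
    and ab: "\<delta> p = a * f p + b * f (p + 1)" "\<delta> (p + 1) = a * f (p + 1) + b * f (p + 2)"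
  proof (cases "even d")
    case True
    then obtain m where m: "d = 2 * m" by blast
    then obtain n where n: "m = Suc n" using l by (cases m) auto
    have f: "f (n + 1) = 0" "f (n + 2) \<noteq> 0" "f n \<noteq> 0"
      using m n neq[of "n + 2" n] by (auto simp: f_def numeral_eq_Suc)
    show thesis
      by (rule that[of n "\<delta> n / f n" "\<delta> (n + 1) / f (n + 2)"]) (use m n f in auto)
  next
    case False
    then obtain m where m: "d = 2 * m + 1" by (rule oddE)
    have m1: "m \<ge> 1" using l l1 m by auto
    have "d - m = m + 1" "d - (m + 1) = m" using m by auto
    then have f: "f (m + 1) = - f m" "f m \<noteq> 0"
      using m neq[of m "m + 1"] by (auto simp: f_def)
    have "f m + f (m + 2) = \<beta> * f (m + 1) + 0"
      using frec m m1 unfolding recurrent_def by auto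
    then have step: "f (m + 2) = \<beta> * f (m + 1) - f m"
      by (simp add: algebra_simps)
    have f2: "f (m + 2) = - (\<beta> + 1) * f m"
      by (simp only: step f(1)) (simp add: algebra_simps)
    \<comment> \<open>The constants solve the two linear equations for \<open>a\<close> and \<open>b\<close>; the sum of the equations has
      no \<open>a\<close>, because \<open>f (m + 1) = - f m\<close>.\<close>
    have b2: "\<beta> + 2 \<noteq> 0" using \<beta> False by (metis add_eq_0_iff2)
    define b where "b = - (\<delta> m + \<delta> (m + 1)) / ((\<beta> + 2) * f m)"
    define a where "a = \<delta> m / f m + b"
    have bf: "b * f m * (\<beta> + 2) = - (\<delta> m + \<delta> (m + 1))"
      using b2 f by (simp add: b_def)
    have af: "a * f m = \<delta> m + b * f m"
      using f by (simp add: a_def algebra_simps)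
    show thesis
    proof (rule that[of m a b])
      show "m + 1 \<le> d - 1" using m m1 by simp
      show "\<delta> m = a * f m + b * f (m + 1)" using af f by simp
      have "a * f (m + 1) + b * f (m + 2) = - (a * f m) - b * f m * (\<beta> + 2) + b * f m"
        unfolding f2 using f by (simp add: algebra_simps)
      then show "\<delta> (m + 1) = a * f (m + 1) + b * f (m + 2)"
        unfolding bf af by simp
    qed
  qed
  define z where "z i = \<delta> i - (a * f i + b * f (i + 1))" for i
  have "recurrent \<beta> 0 (d - 1) z"
    unfolding recurrent_def
  proof (intro allI impI)
    fix i assume i: "i + 2 \<le> d - 1"
    have "i + 1 + 2 \<le> d" "i + 2 \<le> d" using i by auto
    then have "f i + f (i + 2) = \<beta> * f (i + 1)" "f (i + 1) + f (i + 1 + 2) = \<beta> * f (i + 1 + 1)"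
      using frec unfolding recurrent_def by (metis add_0_right)+
    then have f: "f (i + 2) = \<beta> * f (i + 1) - f i"
      "f (i + 2 + 1) = \<beta> * f (i + 1 + 1) - f (i + 1)"
      by (auto simp: algebra_simps numeral_eq_Suc)
    have "\<delta> i + \<delta> (i + 2) = \<beta> * \<delta> (i + 1) + 0"
      using \<delta>rec i unfolding recurrent_def by blast
    then have d: "\<delta> (i + 2) = \<beta> * \<delta> (i + 1) - \<delta> i"
      by (simp add: algebra_simps)
    show "z i + z (i + 2) = \<beta> * z (i + 1) + 0"
      unfolding z_def d f by (simp add: algebra_simps)
  qed
  moreover have "z p = 0" "z (p + 1) = 0"
    using ab by (auto simp: z_def numeral_eq_Suc)
  ultimately have z: "z i = 0" if "i \<le> d - 1" for i
    using recurrent_zero_everywhere p that by blast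
  have "\<theta> 0 - \<theta> l = (\<Sum>h<l. \<delta> h)"
    using sum_lessThan_telescope'[of \<theta> l] by (simp add: \<delta>_def)
  also have "\<dots> = (\<Sum>h<l. a * f h + b * f (h + 1))"
    using z l by (intro sum.cong) (auto simp: z_def)
  also have "\<dots> = a * (\<Sum>h<l. f h) + b * (\<Sum>h<l. f (h + 1))"
    by (simp add: sum.distrib sum_distrib_left)
  also have "\<dots> = 0"
    using S0 S1 by simp
  finally show False
    using neq[of 0 l] l by simp
qed

text \<open>The condition on the base says that \<open>\<theta> i + \<theta> (i + 2) - \<beta> * \<theta> (i + 1)\<close> takes equal values at consecutive indices;
the common value is \<gamma>.\<close>
lemma recurrent_of_base:
  assumes base: "is_base d \<theta> \<theta>s \<beta>" and inj: "inj_on \<theta> {0..d}"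
  shows "\<exists>\<gamma>. recurrent \<beta> \<gamma> d \<theta>"
proof (intro exI)
  define c where "c i = \<theta> i + \<theta> (i + 2) - \<beta> * \<theta> (i + 1)" for i
  have step: "c (Suc i) = c i" if i: "i + 3 \<le> d" for i
  proof -
    have "\<theta> (i + 1) \<noteq> \<theta> (i + 2)"
      using inj_onD[OF inj, of "i + 1" "i + 2"] i by auto
    moreover have "i + 2 \<in> {2..d - 1}" using i by auto
    then have "(\<theta> (i + 2 - 2) - \<theta> (i + 2 + 1)) / (\<theta> (i + 2 - 1) - \<theta> (i + 2)) = \<beta> + 1"
      using base i unfolding is_base_def
      by (metis (no_types, lifting) le_add2 le_trans)
    ultimately have "\<theta> i - \<theta> (i + 3) = (\<beta> + 1) * (\<theta> (i + 1) - \<theta> (i + 2))"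
      by (simp add: divide_eq_eq numeral_eq_Suc)
    then show ?thesis
      by (simp add: c_def algebra_simps numeral_eq_Suc)
  qed
  have "c i = c 0" if "i + 2 \<le> d" for i
    using that by (induction i) (auto simp: step)
  then show "recurrent \<beta> (c 0) d \<theta>"
    unfolding recurrent_def by (metis c_def diff_add_cancel add.commute)
qed

section \<open>Passing between two Newton bases of polynomials\<close>

lemma tau_self [simp]: "tau \<theta> i i = 1"
  by (simp add: tau_def)

lemma tau_Suc: "i \<le> j \<Longrightarrow> tau \<theta> i (Suc j) = tau \<theta> i j * [:- \<theta> j, 1:]"
  by (simp add: tau_def)

lemma tau_split: "i \<le> j \<Longrightarrow> j \<le> k \<Longrightarrow> tau \<theta> i k = tau \<theta> j k * tau \<theta> i j"
  by (simp add: tau_def prod.atLeastLessThan_concat mult.commute)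

text \<open>Induction on \<open>j\<close>: writing \<open>x - \<phi> j\<close> as \<open>(x - \<theta> (j - k)) + (\<theta> (j - k) - \<phi> j)\<close> in the \<open>k\<close>-th summand turns the
claim into a Pascal-type recurrence for the coefficients. After cancelling the common product this
recurrence is the hypothesis on \<open>a\<close>, in which \<open>i\<close> no longer occurs.\<close>
lemma tau_change_of_base:
  fixes \<theta> \<phi> w a :: "nat \<Rightarrow> 'k::field"
  assumes a0: "a 0 = 1"
    and a: "\<And>k j. k \<le> j \<Longrightarrow> j < N \<Longrightarrow>
      a (Suc k) * (w (Suc j) - w (j - k)) = a k * (\<theta> (j - k) - \<phi> j)"
    and ij: "i \<le> j" "j \<le> N"
  shows "tau \<phi> i j = (\<Sum>k=0..j - i. smult (a k * (\<Prod>h<k. w (j - h) - w i)) (tau \<theta> i (j - k)))"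
  using ij
proof (induction j rule: dec_induct)
  case base
  then show ?case using a0 by simp
next
  case (step j)
  define C where "C j k = a k * (\<Prod>h<k. w (j - h) - w i)" for j k
  define T where "T k = tau \<theta> i (j - k)" for k
  have C0: "C j 0 = 1" for j by (simp add: C_def a0)
  have Clast: "C j (Suc (j - i)) = 0"
    using step.hyps by (simp add: C_def)
  \<comment> \<open>The Pascal-type recurrence; the common factor of its three terms is \<open>Q\<close>.\<close>
  have Crec: "C (Suc j) (Suc k) = C j (Suc k) + (\<theta> (j - k) - \<phi> j) * C j k" if k: "k \<le> j - i" for k
  proof -
    define Q where "Q = (\<Prod>h<k. w (j - h) - w i)"
    have "(\<Prod>h<Suc k. w (Suc j - h) - w i) = (w (Suc j) - w i) * Q"
      unfolding Q_def by (subst prod.lessThan_Suc_shift) simp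
    moreover have "(\<Prod>h<Suc k. w (j - h) - w i) = Q * (w (j - k) - w i)"
      by (simp add: Q_def)
    moreover have "a (Suc k) * (w (Suc j) - w (j - k)) = a k * (\<theta> (j - k) - \<phi> j)"
      using a[of k j] k step by simp
    then have "a (Suc k) * ((w (Suc j) - w i) * Q)
        = a (Suc k) * (Q * (w (j - k) - w i)) + (\<theta> (j - k) - \<phi> j) * (a k * Q)"
      by algebra
    ultimately show ?thesis by (simp add: C_def Q_def)
  qed
  have T: "T k * [:- \<phi> j, 1:] = tau \<theta> i (Suc j - k) + smult (\<theta> (j - k) - \<phi> j) (T k)"
    if k: "k \<le> j - i" for k
  proof -
    have "tau \<theta> i (Suc (j - k)) = T k * [:- \<theta> (j - k), 1:]"
      unfolding T_def by (rule tau_Suc) (use k step.hyps in simp)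
    moreover have "Suc (j - k) = Suc j - k" using k by simp
    moreover have "T k * [:- \<phi> j, 1:]
        = T k * [:- \<theta> (j - k), 1:] + T k * [:\<theta> (j - k) - \<phi> j:]"
      by (simp flip: distrib_left del: mult_pCons_right)
    moreover have "T k * [:\<theta> (j - k) - \<phi> j:] = smult (\<theta> (j - k) - \<phi> j) (T k)"
      by simp
    ultimately show ?thesis by metis
  qed
  have "tau \<phi> i (Suc j) = tau \<phi> i j * [:- \<phi> j, 1:]"
    using step.hyps by (simp add: tau_Suc)
  also have "\<dots> = (\<Sum>k=0..j - i. smult (C j k) (T k * [:- \<phi> j, 1:]))"
    using step by (simp add: C_def T_def sum_distrib_right del: mult_pCons_right)
  also have "\<dots> = (\<Sum>k=0..j - i. smult (C j k) (tau \<theta> i (Suc j - k)))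
      + (\<Sum>k=0..j - i. smult ((\<theta> (j - k) - \<phi> j) * C j k) (T k))"
    by (simp add: T smult_add_right sum.distrib mult.commute del: mult_pCons_right)
  also have "(\<Sum>k=0..j - i. smult (C j k) (tau \<theta> i (Suc j - k)))
      = (\<Sum>k=0..Suc (j - i). smult (C j k) (tau \<theta> i (Suc j - k)))"
    by (simp add: Clast)
  also have "\<dots> = tau \<theta> i (Suc j) + (\<Sum>k=0..j - i. smult (C j (Suc k)) (T k))"
    by (subst sum.atLeast0_atMost_Suc_shift) (simp add: C0 T_def)
  also have "tau \<theta> i (Suc j) + (\<Sum>k=0..j - i. smult (C j (Suc k)) (T k))
      + (\<Sum>k=0..j - i. smult ((\<theta> (j - k) - \<phi> j) * C j k) (T k))
      = tau \<theta> i (Suc j) + (\<Sum>k=0..j - i. smult (C (Suc j) (Suc k)) (T k))"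
    by (simp add: Crec smult_add_left sum.distrib)
  also have "\<dots> = (\<Sum>k=0..Suc (j - i). smult (C (Suc j) k) (tau \<theta> i (Suc j - k)))"
    by (subst sum.atLeast0_atMost_Suc_shift) (simp add: C0 T_def)
  also have "Suc (j - i) = Suc j - i" using step.hyps by simp
  finally show ?case by (simp add: C_def)
qed

text \<open>The coefficients of both expansions: those of \<Delta> come from \<theta>, and those of its inverse from the
reversed sequence.\<close>
definition newton_coeff :: "nat \<Rightarrow> (nat \<Rightarrow> 'k::field) \<Rightarrow> nat \<Rightarrow> 'k" where
  "newton_coeff d \<theta> k = (\<Prod>h<k. \<theta> 0 - \<theta> (d - h)) / (\<Prod>i=1..k. vartheta d \<theta> i)"

lemma newton_coeff_0 [simp]: "newton_coeff d \<theta> 0 = 1"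
  by (simp add: newton_coeff_def)

lemma newton_coeff_recurrence:
  assumes rec: "recurrent \<beta> \<gamma> d \<theta>" and nz: "\<And>i. 1 \<le> i \<Longrightarrow> i \<le> d \<Longrightarrow> vartheta d \<theta> i \<noteq> 0"
    and k: "k \<le> j" "j < d"
  shows "newton_coeff d \<theta> (Suc k) * (vartheta d \<theta> (Suc j) - vartheta d \<theta> (j - k))
       = newton_coeff d \<theta> k * (\<theta> (j - k) - \<theta> (d - j))"
proof -
  define w where "w = vartheta d \<theta>"
  have "(\<theta> 0 - \<theta> (d + 1 - Suc k)) * (w (j - k + Suc k) - w (j - k))
      = (\<theta> (j - k) - \<theta> (d + 1 - Suc k - (j - k))) * w (Suc k)"
    unfolding w_def by (rule vartheta_increment_ratio[OF rec]) (use k in auto)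
  moreover have "d + 1 - Suc k - (j - k) = d - j" "j - k + Suc k = Suc j" using k by auto
  ultimately have ratio: "(\<theta> 0 - \<theta> (d - k)) * (w (Suc j) - w (j - k)) = (\<theta> (j - k) - \<theta> (d - j)) * w (Suc k)"
    by simp
  have w: "w (Suc k) \<noteq> 0" using nz[of "Suc k"] k by (simp add: w_def)
  have "newton_coeff d \<theta> (Suc k) = newton_coeff d \<theta> k * ((\<theta> 0 - \<theta> (d - k)) / w (Suc k))"
    by (simp add: newton_coeff_def w_def)
  then have "newton_coeff d \<theta> (Suc k) * (w (Suc j) - w (j - k))
      = newton_coeff d \<theta> k * ((\<theta> 0 - \<theta> (d - k)) * (w (Suc j) - w (j - k)) / w (Suc k))"
    by simp
  also have "\<dots> = newton_coeff d \<theta> k * (\<theta> (j - k) - \<theta> (d - j))"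
    unfolding ratio using w by simp
  finally show ?thesis by (simp add: w_def)
qed

lemma recurrent_reverse:
  assumes "recurrent \<beta> \<gamma> d \<theta>"
  shows "recurrent \<beta> \<gamma> d (\<lambda>i. \<theta> (d - i))"
  unfolding recurrent_def
proof (intro allI impI)
  fix i assume i: "i + 2 \<le> d"
  define m where "m = d - i - 2"
  have m: "d - i = m + 2" "d - (i + 1) = m + 1" "d - (i + 2) = m" "m + 2 \<le> d"
    using i by (auto simp: m_def)
  have "\<theta> m + \<theta> (m + 2) = \<beta> * \<theta> (m + 1) + \<gamma>"
    using assms m(4) unfolding recurrent_def by blast
  then show "\<theta> (d - i) + \<theta> (d - (i + 2)) = \<beta> * \<theta> (d - (i + 1)) + \<gamma>"
    unfolding m by (simp add: add.commute)
qed

lemma vartheta_reverse: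
  assumes "i \<le> Suc d"
  shows "vartheta d (\<lambda>h. \<theta> (d - h)) i = vartheta d \<theta> i"
  unfolding vartheta_def
proof (rule sum.cong)
  fix h assume "h \<in> {0..<i}"
  then have "d - (d - h) = h" using assms by auto
  moreover have "(\<theta> (d - h) - \<theta> h) / (\<theta> d - \<theta> 0) = (\<theta> h - \<theta> (d - h)) / (\<theta> 0 - \<theta> d)"
    by (metis minus_diff_eq minus_divide_divide)
  ultimately show "(\<theta> (d - h) - \<theta> (d - (d - h))) / (\<theta> (d - 0) - \<theta> (d - d))
      = (\<theta> h - \<theta> (d - h)) / (\<theta> 0 - \<theta> d)"
    by simp
qed simp

lemma newton_coeff_eq_eta:
  "newton_coeff d \<theta> k = poly (eta d \<theta> k) (\<theta> 0) / (\<Prod>i=1..k. vartheta d \<theta> i)"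
  by (simp add: newton_coeff_def eta_def poly_prod lessThan_atLeast0)

lemma newton_coeff_reverse_eq_tau:
  assumes "k \<le> d"
  shows "newton_coeff d (\<lambda>h. \<theta> (d - h)) k
    = poly (tau \<theta> 0 k) (\<theta> d) / (\<Prod>i=1..k. vartheta d \<theta> i)"
proof -
  have "(\<Prod>i=1..k. vartheta d (\<lambda>h. \<theta> (d - h)) i) = (\<Prod>i=1..k. vartheta d \<theta> i)"
    using assms by (intro prod.cong) (auto simp: vartheta_reverse)
  moreover have "(\<Prod>h<k. \<theta> d - \<theta> (d - (d - h))) = (\<Prod>h<k. \<theta> d - \<theta> h)"
    using assms by (intro prod.cong) auto
  ultimately show ?thesis
    by (simp add: newton_coeff_def tau_def poly_prod lessThan_atLeast0)
qed

section \<open>Linear maps and sums of subspaces\<close>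

context td_space
begin

abbreviation lin :: "('b \<Rightarrow> 'b) \<Rightarrow> bool" where
  "lin \<equiv> Vector_Spaces.linear scale scale"

lemma linI: "(\<And>x y. f (x + y) = f x + f y) \<Longrightarrow> (\<And>c x. f (c *s x) = c *s f x) \<Longrightarrow> lin f"
  using vector_space_axioms by (simp add: Vector_Spaces.linear_iff)

lemma
  assumes "lin f"
  shows lin_add: "f (x + y) = f x + f y"
    and lin_scale: "f (c *s x) = c *s f x"
    and lin_0: "f 0 = 0"
    and lin_diff: "f (x - y) = f x - f y"
    and lin_sum: "f (\<Sum>i\<in>I. g i) = (\<Sum>i\<in>I. f (g i))"
    and lin_span: "span (f ` S) = f ` span S"
    and lin_vimage: "subspace S \<Longrightarrow> subspace {x. f x \<in> S}"
proof -
  interpret Vector_Spaces.linear scale scale f by fact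
  show "f (x + y) = f x + f y" "f (c *s x) = c *s f x" "f 0 = 0" "f (x - y) = f x - f y"
    "f (\<Sum>i\<in>I. g i) = (\<Sum>i\<in>I. f (g i))" "span (f ` S) = f ` span S"
    "subspace S \<Longrightarrow> subspace {x. f x \<in> S}"
    by (simp_all add: add scale diff sum span_image subspace_linear_preimage)
qed

lemma lin_funpow: "lin f \<Longrightarrow> lin (f ^^ n)"
  by (induction n) (auto intro!: linI simp: lin_add lin_scale)

lemma lin_lincomb:
  "(\<And>k. k \<in> I \<Longrightarrow> lin (f k)) \<Longrightarrow> lin (\<lambda>v. \<Sum>k\<in>I. a k *s f k v)"
  by (rule linI)
    (simp_all add: lin_add lin_scale scale_right_distrib sum.distrib scale_sum_right mult.commute)

lemma lin_minus_scalar: "lin f \<Longrightarrow> lin (\<lambda>x. f x - c *s x)"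
  by (rule linI) (simp_all add: lin_add lin_scale scale_right_distrib scale_right_diff_distrib mult.commute)

lemma subspace_eigenspace: "lin A \<Longrightarrow> subspace (eigenspace A t)"
  unfolding eigenspace_def
  by (rule subspaceI) (simp_all add: lin_0 lin_add lin_scale scale_right_distrib mult.commute)

text \<open>This turns membership in a span of subspaces into a choice of components, the form in which direct
sum decompositions are used below.\<close>
lemma span_UN_iff:
  assumes "finite I" "\<And>h. h \<in> I \<Longrightarrow> subspace (S h)"
  shows "x \<in> span (\<Union>h\<in>I. S h) \<longleftrightarrow> (\<exists>c. (\<forall>h\<in>I. c h \<in> S h) \<and> x = (\<Sum>h\<in>I. c h))"
proof
  define M where "M = {(\<Sum>h\<in>I. c h) | c. \<forall>h\<in>I. c h \<in> S h}"
  have "subspace M"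
  proof (rule subspaceI)
    show "0 \<in> M"
      unfolding M_def using assms(2) by (auto intro!: exI[of _ "\<lambda>_. 0"] simp: subspace_0)
  next
    fix x y assume "x \<in> M" "y \<in> M"
    then obtain a b where "\<forall>h\<in>I. a h \<in> S h" "\<forall>h\<in>I. b h \<in> S h"
      "x = (\<Sum>h\<in>I. a h)" "y = (\<Sum>h\<in>I. b h)"
      unfolding M_def by blast
    then show "x + y \<in> M"
      unfolding M_def using assms(2)
      by (auto intro!: exI[of _ "\<lambda>h. a h + b h"] simp: sum.distrib subspace_add)
  next
    fix c x assume "x \<in> M"
    then obtain a where "\<forall>h\<in>I. a h \<in> S h" "x = (\<Sum>h\<in>I. a h)"
      unfolding M_def by blast
    then show "c *s x \<in> M"
      unfolding M_def using assms(2)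
      by (auto intro!: exI[of _ "\<lambda>h. c *s a h"] simp: scale_sum_right subspace_scale)
  qed
  moreover have "(\<Union>h\<in>I. S h) \<subseteq> M"
  proof
    fix y assume "y \<in> (\<Union>h\<in>I. S h)"
    then obtain k where k: "k \<in> I" "y \<in> S k" by blast
    have "y = (\<Sum>h\<in>I. if h = k then y else 0)"
      using assms(1) k by simp
    then show "y \<in> M"
      unfolding M_def using k assms(2)
      by (auto intro!: exI[of _ "\<lambda>h. if h = k then y else 0"] simp: subspace_0)
  qed
  ultimately have "span (\<Union>h\<in>I. S h) \<subseteq> M"
    by (rule span_minimal[rotated])
  then show "\<exists>c. (\<forall>h\<in>I. c h \<in> S h) \<and> x = (\<Sum>h\<in>I. c h)" if "x \<in> span (\<Union>h\<in>I. S h)"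
    using that unfolding M_def by blast
next
  assume "\<exists>c. (\<forall>h\<in>I. c h \<in> S h) \<and> x = (\<Sum>h\<in>I. c h)"
  then show "x \<in> span (\<Union>h\<in>I. S h)"
    by (blast intro: span_sum span_base)
qed

lemma sum_subspaces_eq_span:
  assumes "finite I" "\<And>h. h \<in> I \<Longrightarrow> subspace (S h)"
  shows "(\<Sum>h\<in>I. S h) = span (\<Union>h\<in>I. S h)"
  using assms
proof (induction I rule: finite_induct)
  case empty
  then show ?case by (simp add: set_zero)
next
  case (insert k I)
  have "span (\<Union>h\<in>insert k I. S h) = {x + y |x y. x \<in> span (S k) \<and> y \<in> span (\<Union>h\<in>I. S h)}"
    by (simp add: span_Un)
  also have "\<dots> = S k + (\<Sum>h\<in>I. S h)"
    using insert by (auto simp: set_plus_def span_eq_iff[THEN iffD2])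
  finally show ?case using insert by simp
qed

text \<open>The hypotheses say that the space is the direct sum of the injective images \<open>T p ` K p\<close>, with the
summands parametrised by the \<open>K p\<close>. Such a parametrisation gives the existence and uniqueness behind the
definite descriptions that define the split projections and \<Psi>.\<close>
lemma unique_linear_extension:
  fixes T S :: "'i \<Rightarrow> 'b \<Rightarrow> 'b" and K :: "'i \<Rightarrow> 'b set"
  assumes fin: "finite I"
    and K: "\<And>p. p \<in> I \<Longrightarrow> subspace (K p)"
    and T: "\<And>p. p \<in> I \<Longrightarrow> lin (T p)"
    and S: "\<And>p. p \<in> I \<Longrightarrow> lin (S p)"
    and spanning: "span (\<Union>p\<in>I. T p ` K p) = UNIV"
    and independent: "\<And>c. (\<And>p. p \<in> I \<Longrightarrow> c p \<in> K p) \<Longrightarrow> (\<Sum>p\<in>I. T p (c p)) = 0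
      \<Longrightarrow> (\<And>p. p \<in> I \<Longrightarrow> c p = 0)"
  shows "\<exists>!P. lin P \<and> (\<forall>p\<in>I. \<forall>v\<in>K p. P (T p v) = S p v)"
proof -
  have "\<exists>c. (\<forall>p\<in>I. c p \<in> K p) \<and> x = (\<Sum>p\<in>I. T p (c p))" for x
  proof -
    have "x \<in> span (\<Union>p\<in>I. T p ` K p)" using spanning by simp
    moreover have "subspace (T p ` K p)" if "p \<in> I" for p
      using lin_span[OF T[OF that], of "K p"] K[OF that] by (metis span_eq_iff subspace_span)
    ultimately obtain y where y: "\<forall>p\<in>I. y p \<in> T p ` K p" "x = (\<Sum>p\<in>I. y p)"
      using fin by (subst (asm) span_UN_iff) auto
    then have "\<forall>p\<in>I. \<exists>c. c \<in> K p \<and> y p = T p c" by blast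
    then obtain c where "\<forall>p\<in>I. c p \<in> K p \<and> y p = T p (c p)"
      by metis
    then show ?thesis using y(2) by auto
  qed
  then obtain c where c: "\<And>x p. p \<in> I \<Longrightarrow> c x p \<in> K p" "\<And>x. x = (\<Sum>p\<in>I. T p (c x p))"
    by metis
  have uniq: "c x p = a p"
    if "\<And>p. p \<in> I \<Longrightarrow> a p \<in> K p" "x = (\<Sum>p\<in>I. T p (a p))" "p \<in> I" for x a p
  proof -
    have "(\<Sum>p\<in>I. T p (c x p - a p)) = (\<Sum>p\<in>I. T p (c x p)) - (\<Sum>p\<in>I. T p (a p))"
      by (simp add: T lin_diff sum_subtractf)
    also have "\<dots> = 0" using c(2)[of x] that(2) by simp
    finally have "c x p - a p = 0"
      using independent[of "\<lambda>p. c x p - a p"] c(1) K that by (simp add: subspace_diff)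
    then show ?thesis by simp
  qed
  define P where "P x = (\<Sum>p\<in>I. S p (c x p))" for x
  have "lin P"
  proof (rule linI)
    fix x y
    have "c (x + y) p = c x p + c y p" if "p \<in> I" for p
      using c(2)[of x] c(2)[of y] that
      by (intro uniq) (auto simp: K c(1) subspace_add T lin_add sum.distrib)
    then show "P (x + y) = P x + P y"
      by (simp add: P_def S lin_add sum.distrib)
  next
    fix a x
    have "c (a *s x) p = a *s c x p" if "p \<in> I" for p
      using c(2)[of x] that
      by (intro uniq) (auto simp: K c(1) subspace_scale T lin_scale simp flip: scale_sum_right)
    then show "P (a *s x) = a *s P x"
      by (simp add: P_def S lin_scale scale_sum_right)
  qed
  moreover have "P (T q v) = S q v" if "q \<in> I" "v \<in> K q" for q v
  proof -
    have "c (T q v) p = (if p = q then v else 0)" if p: "p \<in> I" for p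
    proof (rule uniq)
      show "T q v = (\<Sum>p\<in>I. T p (if p = q then v else 0))"
        using fin \<open>q \<in> I\<close> T by (subst sum.remove[of _ q]) (auto simp: lin_0 intro!: sum.neutral)
    next
      fix p assume "p \<in> I"
      then show "(if p = q then v else 0) \<in> K p"
        using \<open>v \<in> K q\<close> K by (simp add: subspace_0)
    qed (rule p)
    then have "P (T q v) = (\<Sum>p\<in>I. S p (if p = q then v else 0))"
      unfolding P_def by (intro sum.cong) auto
    also have "\<dots> = S q v"
      using fin \<open>q \<in> I\<close> S by (subst sum.remove[of _ q]) (auto simp: lin_0 intro!: sum.neutral)
    finally show ?thesis .
  qed
  moreover have "Q = P'" if Q: "lin Q" "\<forall>p\<in>I. \<forall>v\<in>K p. Q (T p v) = S p v"
    and P': "lin P'" "\<forall>p\<in>I. \<forall>v\<in>K p. P' (T p v) = S p v" for Q P'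
  proof
    fix x
    have "Q (\<Sum>p\<in>I. T p (c x p)) = P' (\<Sum>p\<in>I. T p (c x p))"
      using Q P' c(1) by (simp add: lin_sum)
    then show "Q x = P' x" using c(2)[of x] by simp
  qed
  ultimately show ?thesis by blast
qed

lemma lin_eqI:
  assumes "lin f" "lin g" "span S = UNIV" "\<And>x. x \<in> S \<Longrightarrow> f x = g x"
  shows "f = g"
proof
  fix x
  have "subspace {x. f x - g x = 0}"
    by (rule subspaceI)
      (simp_all add: assms(1,2) lin_0 lin_add lin_scale flip: scale_right_diff_distrib)
  then have "span S \<subseteq> {x. f x - g x = 0}"
    using assms(4) by (intro span_minimal) auto
  then show "f x = g x" using assms(3) by auto
qed

section \<open>Polynomials in a linear map\<close>

lemma poly_apply_eq:
  assumes "degree p \<le> N"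
  shows "poly_apply p A v = (\<Sum>n\<le>N. coeff p n *s (A ^^ n) v)"
  unfolding poly_apply_def atLeast0AtMost using assms
  by (intro sum.mono_neutral_left) (auto simp: coeff_eq_0)

lemma poly_apply_0 [simp]: "poly_apply 0 A v = 0"
  by (simp add: poly_apply_def)

lemma poly_apply_1 [simp]: "poly_apply 1 A v = v"
  by (simp add: poly_apply_def)

lemma poly_apply_add: "poly_apply (p + q) A v = poly_apply p A v + poly_apply q A v"
  using poly_apply_eq[of p "max (degree p) (degree q)" A v]
    poly_apply_eq[of q "max (degree p) (degree q)" A v]
    poly_apply_eq[of "p + q" "max (degree p) (degree q)" A v]
  by (simp add: degree_add_le scale_left_distrib sum.distrib)

lemma poly_apply_smult: "poly_apply (smult c p) A v = c *s poly_apply p A v"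
  using poly_apply_eq[of "smult c p" "degree p" A v] poly_apply_eq[of p "degree p" A v]
  by (simp add: degree_smult_le scale_sum_right)

lemma poly_apply_sum: "poly_apply (\<Sum>k\<in>I. p k) A v = (\<Sum>k\<in>I. poly_apply (p k) A v)"
  by (induction I rule: infinite_finite_induct) (simp_all add: poly_apply_add)

lemma poly_apply_pCons:
  assumes "lin A"
  shows "poly_apply (pCons c p) A v = c *s v + A (poly_apply p A v)"
proof -
  have "poly_apply (pCons c p) A v = (\<Sum>n\<le>Suc (degree p). coeff (pCons c p) n *s (A ^^ n) v)"
    by (rule poly_apply_eq) (simp add: degree_pCons_le)
  also have "\<dots> = c *s v + (\<Sum>n\<le>degree p. coeff p n *s A ((A ^^ n) v))"
    by (subst sum.atMost_Suc_shift) simp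
  also have "(\<Sum>n\<le>degree p. coeff p n *s A ((A ^^ n) v)) = A (poly_apply p A v)"
    unfolding poly_apply_def atLeast0AtMost by (simp add: assms lin_sum lin_scale)
  finally show ?thesis .
qed

lemma poly_apply_lin: "lin A \<Longrightarrow> lin (poly_apply p A)"
  by (induction p)
    (auto intro!: linI simp: poly_apply_pCons lin_add lin_scale scale_right_distrib mult.commute)

lemma poly_apply_mult:
  assumes "lin A"
  shows "poly_apply (p * q) A v = poly_apply p A (poly_apply q A v)"
  by (induction p) (simp_all add: assms poly_apply_pCons poly_apply_add poly_apply_smult)

lemma poly_apply_eigenvector:
  assumes "lin A" "v \<in> eigenspace A t"
  shows "poly_apply p A v = poly p t *s v"
  using assms(2)
  by (induction p)
    (simp_all add: assms(1) poly_apply_pCons lin_scale eigenspace_def scale_left_distrib mult.commute)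

lemma poly_apply_tau_Suc:
  assumes "lin A" "i \<le> j"
  shows "poly_apply (tau t i (Suc j)) A v
     = A (poly_apply (tau t i j) A v) - t j *s poly_apply (tau t i j) A v"
  using assms by (simp add: tau_Suc mult.commute[of _ "[:_, 1:]"] poly_apply_mult poly_apply_pCons lin_0
      del: mult_pCons_right mult_pCons_left)

lemma poly_apply_tau_split:
  assumes "lin A" "i \<le> j" "j \<le> k"
  shows "poly_apply (tau t i k) A v = poly_apply (tau t j k) A (poly_apply (tau t i j) A v)"
  using tau_split[OF assms(2,3), of t] assms(1) by (simp add: poly_apply_mult)

lemma poly_apply_tau_front:
  assumes "lin A" "i < k"
  shows "poly_apply (tau t i k) A v = poly_apply (tau t (Suc i) k) A (A v - t i *s v)"
  using poly_apply_tau_split[OF assms(1), of i "Suc i" k t v] assms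
    poly_apply_tau_Suc[OF assms(1), of i i t v]
  by simp

section \<open>Sums of eigenspaces\<close>

text \<open>The eigenspaces enter through a scalar sequence, so that reversing the sequence reverses the
ordering, and sums over index sets become sums of consecutive eigenspaces.\<close>
definition eigensum :: "('b \<Rightarrow> 'b) \<Rightarrow> (nat \<Rightarrow> 'a) \<Rightarrow> nat set \<Rightarrow> 'b set" where
  "eigensum A t I = span (\<Union>h\<in>I. eigenspace A (t h))"

lemma subspace_eigensum [simp]: "subspace (eigensum A t I)"
  by (simp add: eigensum_def)

lemma eigensum_mono: "I \<subseteq> J \<Longrightarrow> eigensum A t I \<subseteq> eigensum A t J"
  unfolding eigensum_def by (intro span_mono) auto

lemma eigensum_base: "x \<in> eigenspace A (t h) \<Longrightarrow> h \<in> I \<Longrightarrow> x \<in> eigensum A t I"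
  unfolding eigensum_def by (intro span_base) auto

lemma eigensum_empty [simp]: "eigensum A t {} = {0}"
  by (simp add: eigensum_def)

lemma eigensum_reindex: "eigensum A (\<lambda>h. t (f h)) I = eigensum A t (f ` I)"
  by (simp add: eigensum_def)

lemma eigensum_maps_to:
  assumes "lin f" "subspace S" "\<And>h y. h \<in> I \<Longrightarrow> y \<in> eigenspace A (t h) \<Longrightarrow> f y \<in> S"
    and "x \<in> eigensum A t I"
  shows "f x \<in> S"
proof -
  have "span (\<Union>h\<in>I. eigenspace A (t h)) \<subseteq> {x. f x \<in> S}"
    using assms(3) by (intro span_minimal lin_vimage assms) auto
  then show ?thesis using assms(4) by (auto simp: eigensum_def)
qed

lemma eigensum_minus_eigenvalue:
  assumes "lin A" "x \<in> eigensum A t I"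
  shows "A x - t k *s x \<in> eigensum A t (I - {k})"
proof (rule eigensum_maps_to[OF _ _ _ assms(2), where f = "\<lambda>x. A x - t k *s x"])
  fix h y assume h: "h \<in> I" and y: "y \<in> eigenspace A (t h)"
  then have e: "A y - t k *s y = (t h - t k) *s y"
    by (simp add: eigenspace_def scale_left_diff_distrib)
  show "A y - t k *s y \<in> eigensum A t (I - {k})"
  proof (cases "h = k")
    case True
    then show ?thesis unfolding e by (simp add: subspace_0)
  next
    case False
    then show ?thesis
      unfolding e using h y by (intro subspace_scale eigensum_base[of _ _ _ h]) auto
  qed
qed (simp_all add: assms lin_minus_scalar)

lemma poly_apply_eigensum_zero:
  assumes "lin A" "finite I" "x \<in> eigensum A t I"
  shows "poly_apply (\<Prod>h\<in>I. [:- t h, 1:]) A x = 0"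
proof -
  have "poly_apply (\<Prod>h\<in>I. [:- t h, 1:]) A x \<in> {0}"
  proof (rule eigensum_maps_to[OF poly_apply_lin _ _ assms(3)])
    fix h y assume "h \<in> I" "y \<in> eigenspace A (t h)"
    then show "poly_apply (\<Prod>h\<in>I. [:- t h, 1:]) A y \<in> {0}"
      using assms by (auto simp: poly_apply_eigenvector poly_prod)
  qed (simp_all add: assms)
  then show ?thesis by simp
qed

lemma eigenvectors_independent:
  assumes A: "lin A" and fin: "finite I" and inj: "inj_on t I"
    and y: "\<And>h. h \<in> I \<Longrightarrow> y h \<in> eigenspace A (t h)" and sum0: "(\<Sum>h\<in>I. y h) = 0"
    and k: "k \<in> I"
  shows "y k = 0"
proof -
  define p where "p = (\<Prod>h\<in>I - {k}. [:- t h, 1:])"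
  have "0 = poly_apply p A (\<Sum>h\<in>I. y h)"
    using sum0 lin_0[OF poly_apply_lin[OF A]] by simp
  also have "\<dots> = (\<Sum>h\<in>I. poly p (t h) *s y h)"
    by (simp add: lin_sum[OF poly_apply_lin[OF A]] poly_apply_eigenvector[OF A y])
  also have "\<dots> = poly p (t k) *s y k"
    using fin k by (subst sum.remove[of _ k]) (auto simp: p_def poly_prod intro!: sum.neutral)
  finally have "poly p (t k) *s y k = 0" by simp
  moreover have "poly p (t k) \<noteq> 0"
    using fin inj k by (auto simp: p_def poly_prod inj_on_def)
  ultimately show ?thesis by simp
qed

text \<open>Describing a sum of eigenspaces as a kernel translates between the flags and the polynomials
\<open>tau\<close>: it yields both the injectivity of \<open>tau\<close> on split components and the description of \<open>K\<close>.\<close>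
lemma eigensum_eq_kernel:
  assumes A: "lin A" and fin: "finite J" and inj: "inj_on t J" and full: "eigensum A t J = UNIV"
    and IJ: "I \<subseteq> J"
  shows "x \<in> eigensum A t I \<longleftrightarrow> poly_apply (\<Prod>h\<in>I. [:- t h, 1:]) A x = 0"
proof
  assume "x \<in> eigensum A t I"
  then show "poly_apply (\<Prod>h\<in>I. [:- t h, 1:]) A x = 0"
    using A IJ fin by (intro poly_apply_eigensum_zero) (auto intro: finite_subset)
next
  assume zero: "poly_apply (\<Prod>h\<in>I. [:- t h, 1:]) A x = 0"
  define p where "p = (\<Prod>h\<in>I. [:- t h, 1:])"
  have finI: "finite I" using IJ fin by (rule finite_subset)
  have "x \<in> span (\<Union>h\<in>J. eigenspace A (t h))"
    using full by (simp add: eigensum_def)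
  then obtain y where y: "\<And>h. h \<in> J \<Longrightarrow> y h \<in> eigenspace A (t h)" "x = (\<Sum>h\<in>J. y h)"
    using fin A by (subst (asm) span_UN_iff) (auto simp: subspace_eigenspace)
  have "(\<Sum>h\<in>J. poly p (t h) *s y h) = 0"
    using zero unfolding y(2) p_def[symmetric]
    by (simp add: lin_sum[OF poly_apply_lin[OF A]] poly_apply_eigenvector[OF A y(1)])
  then have c: "poly p (t h) *s y h = 0" if "h \<in> J" for h
    by (rule eigenvectors_independent[OF A fin inj _ _ that, rotated])
      (use y(1) A in \<open>auto intro: subspace_scale subspace_eigenspace\<close>)
  have "y h = 0" if "h \<in> J - I" for h
  proof -
    have "poly p (t h) \<noteq> 0"
      using that inj IJ finI by (auto simp: p_def poly_prod inj_on_def)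
    then show ?thesis using c[of h] that by simp
  qed
  then have "x = (\<Sum>h\<in>I. y h)"
    unfolding y(2) using fin IJ by (intro sum.mono_neutral_right) auto
  also have "\<dots> \<in> eigensum A t I"
    using y(1) IJ by (intro subspace_sum eigensum_base) auto
  finally show "x \<in> eigensum A t I" .
qed

end

section \<open>Opposite flags of a tridiagonal pair\<close>

text \<open>One half of the symmetric definition of a tridiagonal pair: \<open>A\<close> is diagonalizable with eigenvalues
\<open>t\<close>, and \<open>B\<close> is tridiagonal with respect to the eigenspaces of \<open>A\<close>. The half is stable under reversing
\<open>t\<close>.\<close>
locale tridiagonal_chain = td_space scale
  for scale :: "'a::field \<Rightarrow> 'b::ab_group_add \<Rightarrow> 'b" (infixr \<open>*s\<close> 75) +
  fixes d :: nat and A B :: "'b \<Rightarrow> 'b" and t :: "nat \<Rightarrow> 'a"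
  assumes lin_A: "lin A" and lin_B: "lin B"
    and inj_t: "inj_on t {..d}"
    and full: "eigensum A t {..d} = UNIV"
    and nonzero: "i \<le> d \<Longrightarrow> eigenspace A (t i) \<noteq> {0}"
    and tridiagonal: "i \<le> d \<Longrightarrow> x \<in> eigenspace A (t i) \<Longrightarrow>
      B x \<in> eigensum A t ({i - 1..i + 1} \<inter> {..d})"
begin

lemma reverse: "tridiagonal_chain scale d A B (\<lambda>i. t (d - i))"
proof (intro tridiagonal_chain.intro tridiagonal_chain_axioms.intro td_space_axioms)
  have img: "(\<lambda>i. d - i) ` {..d} = {..d}"
  proof (intro subset_antisym subsetI)
    fix h assume "h \<in> {..d}"
    then show "h \<in> (\<lambda>i. d - i) ` {..d}"
      by (intro image_eqI[of _ _ "d - h"]) auto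
  qed auto
  show "lin A" by (fact lin_A)
  show "lin B" by (fact lin_B)
  show "inj_on (\<lambda>i. t (d - i)) {..d}"
  proof (rule inj_onI)
    fix x y assume "x \<in> {..d}" "y \<in> {..d}" "t (d - x) = t (d - y)"
    then show "x = y" using inj_onD[OF inj_t, of "d - x" "d - y"] by auto
  qed
  show "eigensum A (\<lambda>i. t (d - i)) {..d} = UNIV"
    by (simp add: eigensum_reindex img full)
  show "eigenspace A (t (d - i)) \<noteq> {0}" if "i \<le> d" for i
    by (rule nonzero) simp
  show "B x \<in> eigensum A (\<lambda>i. t (d - i)) ({i - 1..i + 1} \<inter> {..d})"
    if "i \<le> d" "x \<in> eigenspace A (t (d - i))" for i x
  proof -
    have "{d - i - 1..d - i + 1} \<inter> {..d} \<subseteq> (\<lambda>i. d - i) ` ({i - 1..i + 1} \<inter> {..d})"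
    proof
      fix k assume "k \<in> {d - i - 1..d - i + 1} \<inter> {..d}"
      then show "k \<in> (\<lambda>i. d - i) ` ({i - 1..i + 1} \<inter> {..d})"
        using that(1) by (intro image_eqI[of _ _ "d - k"]) auto
    qed
    then show ?thesis
      unfolding eigensum_reindex
      using tridiagonal[of "d - i" x] that eigensum_mono by (meson diff_le_self subsetD)
  qed
qed

lemma kernel_iff: "I \<subseteq> {..d} \<Longrightarrow>
    x \<in> eigensum A t I \<longleftrightarrow> poly_apply (\<Prod>h\<in>I. [:- t h, 1:]) A x = 0"
  by (rule eigensum_eq_kernel[OF lin_A _ inj_t full]) auto

lemma in_eigensum_of_tau_zero:
  assumes "poly_apply (tau t i j) A x = 0" "i \<le> j" "j \<le> Suc d"
  shows "x \<in> eigensum A t {i..<j}"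
  using assms by (subst kernel_iff) (auto simp: tau_def)

lemma tau_zero_of_eigensum:
  assumes "x \<in> eigensum A t {i..<j}" "i \<le> j"
  shows "poly_apply (tau t i j) A x = 0"
  using poly_apply_eigensum_zero[OF lin_A _ assms(1)] assms(2) by (simp add: tau_def)

lemma B_eigensum:
  assumes "x \<in> eigensum A t I" "I \<subseteq> {..d}" "\<And>h. h \<in> I \<Longrightarrow> {h - 1..h + 1} \<inter> {..d} \<subseteq> J"
  shows "B x \<in> eigensum A t J"
proof (rule eigensum_maps_to[OF lin_B subspace_eigensum _ assms(1)])
  fix h y assume "h \<in> I" "y \<in> eigenspace A (t h)"
  then have "B y \<in> eigensum A t ({h - 1..h + 1} \<inter> {..d})"
    using assms(2) by (intro tridiagonal) auto
  then show "B y \<in> eigensum A t J"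
    using eigensum_mono[OF assms(3)[OF \<open>h \<in> I\<close>]] by (rule subsetD[rotated])
qed

lemma eigensum_UNIV: "{..d} \<subseteq> I \<Longrightarrow> eigensum A t I = UNIV"
  using full eigensum_mono[of "{..d}" I A t] by auto

lemma eigensum_proper:
  assumes "k \<le> d" "k \<notin> I" "I \<subseteq> {..d}"
  shows "eigensum A t I \<noteq> UNIV"
proof
  assume U: "eigensum A t I = UNIV"
  obtain x where x: "x \<in> eigenspace A (t k)" "x \<noteq> 0"
    using nonzero[OF assms(1)] subspace_0[OF subspace_eigenspace[OF lin_A]] by blast
  have "poly_apply (\<Prod>h\<in>I. [:- t h, 1:]) A x = 0"
    using U kernel_iff[OF assms(3)] by auto
  then have "poly (\<Prod>h\<in>I. [:- t h, 1:]) (t k) = 0"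
    using x by (simp add: poly_apply_eigenvector[OF lin_A])
  moreover have "finite I" using assms(3) finite_subset by blast
  ultimately show False
    using inj_t assms by (auto simp: poly_prod inj_on_def)
qed

end

locale tridiagonal_pair =
  td_space scale + finite_dimensional_vector_space scale Basis +
  chain: tridiagonal_chain scale d A As t + dual: tridiagonal_chain scale d As A ts
  for scale :: "'a::field \<Rightarrow> 'b::ab_group_add \<Rightarrow> 'b" (infixr \<open>*s\<close> 75)
    and Basis d A As t ts +
  assumes irreducible: "subspace W \<Longrightarrow> (\<And>x. x \<in> W \<Longrightarrow> A x \<in> W) \<Longrightarrow> (\<And>x. x \<in> W \<Longrightarrow> As x \<in> W)
    \<Longrightarrow> W = {0} \<or> W = UNIV"
begin

lemma reverse: "tridiagonal_pair scale Basis d A As (\<lambda>i. t (d - i)) ts"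
proof -
  interpret rev: tridiagonal_chain scale d A As "\<lambda>i. t (d - i)" by (rule chain.reverse)
  show ?thesis by unfold_locales (rule irreducible)
qed

lemma reverse_dual: "tridiagonal_pair scale Basis d A As t (\<lambda>i. ts (d - i))"
proof -
  interpret rev: tridiagonal_chain scale d As A "\<lambda>i. ts (d - i)" by (rule dual.reverse)
  show ?thesis by unfold_locales (rule irreducible)
qed

text \<open>Here \<open>F i\<close> is the sum of the \<open>i\<close> eigenspaces of \<open>As\<close> with indices below \<open>i\<close>, so that \<open>F 0\<close> is the zero
subspace and \<open>U i\<close> involves \<open>F (Suc i)\<close>.\<close>
definition F :: "nat \<Rightarrow> 'b set" where "F i = eigensum As ts {..<i}"
definition G :: "nat \<Rightarrow> 'b set" where "G j = eigensum A t {j..d}"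
definition U :: "nat \<Rightarrow> 'b set" where "U i = F (Suc i) \<inter> G i"
definition K :: "nat \<Rightarrow> 'b set" where "K i = F (Suc i) \<inter> eigensum A t {i..d - i}"

lemma subspaces [simp]: "subspace (F i)" "subspace (G i)" "subspace (U i)" "subspace (K i)"
  by (simp_all add: F_def G_def U_def K_def subspace_inter)

lemma F_0 [simp]: "F 0 = {0}" by (simp add: F_def)
lemma F_mono: "i \<le> j \<Longrightarrow> F i \<subseteq> F j" by (auto simp: F_def intro!: eigensum_mono)
lemma F_UNIV: "d < i \<Longrightarrow> F i = UNIV" by (auto simp: F_def intro!: dual.eigensum_UNIV)
lemma G_mono: "i \<le> j \<Longrightarrow> G j \<subseteq> G i" by (auto simp: G_def intro!: eigensum_mono)
lemma G_empty: "d < j \<Longrightarrow> G j = {0}" by (simp add: G_def)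
lemma G_UNIV: "G 0 = UNIV" by (auto simp: G_def intro!: chain.eigensum_UNIV)

lemma A_F: assumes "x \<in> F i" shows "A x \<in> F (Suc i)"
proof (cases "i \<le> Suc d")
  case True
  then show ?thesis
    using assms unfolding F_def by (elim dual.B_eigensum) auto
next
  case False
  then show ?thesis by (simp add: F_UNIV)
qed

lemma As_F: "x \<in> F (Suc i) \<Longrightarrow> As x - ts i *s x \<in> F i"
  using eigensum_minus_eigenvalue[OF dual.lin_A, of x ts "{..<Suc i}" i]
  by (simp add: F_def lessThan_Suc)

lemma As_G: "x \<in> G j \<Longrightarrow> As x \<in> G (j - 1)"
  unfolding G_def by (elim chain.B_eigensum) auto

lemma A_G: assumes "x \<in> G j" shows "A x - t j *s x \<in> G (Suc j)"
proof -
  have "{j..d} - {j} = {Suc j..d}" by auto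
  then show ?thesis
    using eigensum_minus_eigenvalue[OF chain.lin_A, of x t "{j..d}" j] assms by (simp add: G_def)
qed

lemma A_F_shift: "x \<in> F i \<Longrightarrow> A x - c *s x \<in> F (Suc i)"
  using A_F[of x i] F_mono[of i "Suc i"] by (auto intro!: subspace_diff subspace_scale)

lemma As_G_shift: "x \<in> G j \<Longrightarrow> As x - c *s x \<in> G (j - 1)"
  using As_G[of x j] G_mono[of "j - 1" j] by (auto intro!: subspace_diff subspace_scale)

text \<open>On the \<open>r\<close>-th diagonal of intersections of the two flags, \<open>A\<close> raises and \<open>As\<close> lowers the index by one, up to
scalars. The span of the diagonal is thus invariant under both maps.\<close>
lemma diagonal_span_trivial:
  defines "S \<equiv> \<lambda>r. span (\<Union>i\<in>{i. i + r \<le> d}. F (Suc i) \<inter> G (i + r))"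
  shows "S r = {0} \<or> S r = UNIV"
proof (rule irreducible)
  show "subspace (S r)" by (simp add: S_def)
  have base: "x \<in> S r" if "x \<in> F (Suc i) \<inter> G (i + r)" for x i
  proof (cases "i + r \<le> d")
    case True
    then show ?thesis unfolding S_def using that by (intro span_base) auto
  next
    case False
    then show ?thesis using that by (simp add: G_empty S_def span_zero)
  qed
  have inv: "f x \<in> S r" if "lin f" "x \<in> S r"
    "\<And>i y. y \<in> F (Suc i) \<inter> G (i + r) \<Longrightarrow> f y \<in> S r" for f x
  proof -
    have "S r \<subseteq> {x. f x \<in> S r}"
      unfolding S_def
      by (intro span_minimal lin_vimage[OF that(1)] subspace_span)
        (use that(3) in \<open>auto simp: S_def\<close>)
    then show ?thesis using that(2) by blast
  qed
  show "A x \<in> S r" if "x \<in> S r" for x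
  proof (rule inv[OF chain.lin_A that])
    fix i y assume y: "y \<in> F (Suc i) \<inter> G (i + r)"
    have "A y - t (i + r) *s y \<in> S r"
      using y A_F_shift[of y "Suc i"] A_G[of y "i + r"] by (intro base[of _ "Suc i"]) simp
    moreover have "t (i + r) *s y \<in> S r"
      unfolding S_def by (rule span_scale) (rule base[OF y, unfolded S_def])
    ultimately have "(A y - t (i + r) *s y) + t (i + r) *s y \<in> S r"
      unfolding S_def by (rule span_add)
    then show "A y \<in> S r" by simp
  qed
  show "As x \<in> S r" if "x \<in> S r" for x
  proof (rule inv[OF chain.lin_B that])
    fix i y assume y: "y \<in> F (Suc i) \<inter> G (i + r)"
    have y': "As y - ts i *s y \<in> F i \<inter> G (i + r - 1)"
      using y As_F[of y i] As_G_shift[of y "i + r"] by simp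
    have "As y - ts i *s y \<in> S r"
    proof (cases i)
      case 0
      then show ?thesis using y' by (simp add: S_def span_zero)
    next
      case (Suc k)
      then show ?thesis using y' by (intro base[of _ k]) simp
    qed
    moreover have "ts i *s y \<in> S r"
      unfolding S_def by (rule span_scale) (rule base[OF y, unfolded S_def])
    ultimately have "(As y - ts i *s y) + ts i *s y \<in> S r"
      unfolding S_def by (rule span_add)
    then show "As y \<in> S r" by simp
  qed
qed

text \<open>Below the main diagonal the invariant span lies in the proper subspace \<open>G 1\<close>, so by irreducibility
it is zero. Applied to reversed orderings, this statement supplies all trivial intersections used
in the sequel.\<close>
lemma F_meet_G:
  assumes "i \<le> j" "x \<in> F i" "x \<in> G j"
  shows "x = 0"
proof (cases "i = 0 \<or> d < j")
  case True
  then show ?thesis using assms G_empty by auto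
next
  case False
  \<comment> \<open>As \<open>F i\<close> is indexed by the number of its eigenspaces, \<open>F i \<inter> G j\<close> is the entry \<open>i - 1\<close> of diagonal \<open>r\<close>.\<close>
  define r where "r = j - i + 1"
  define S where "S = span (\<Union>i\<in>{i. i + r \<le> d}. F (Suc i) \<inter> G (i + r))"
  have "S \<subseteq> G 1"
    unfolding S_def
  proof (rule span_minimal)
    show "(\<Union>i\<in>{i. i + r \<le> d}. F (Suc i) \<inter> G (i + r)) \<subseteq> G 1"
      using G_mono[of 1] by (fastforce simp: r_def)
  qed simp
  moreover have "G 1 \<noteq> UNIV"
    unfolding G_def by (rule chain.eigensum_proper[of 0]) auto
  ultimately have "S = {0}"
    using diagonal_span_trivial[of r] by (auto simp: S_def)
  moreover have "x \<in> S"
    unfolding S_def using assms False by (intro span_base) (auto simp: r_def intro!: exI[of _ "i - 1"])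
  ultimately show ?thesis by simp
qed

text \<open>The main diagonal contains the first eigenspace of \<open>As\<close>, so its invariant span is the whole space.\<close>
lemma span_U: "span (\<Union>i\<in>{..d}. U i) = UNIV"
proof -
  have "{i. i + 0 \<le> d} = {..d}" by auto
  then have "span (\<Union>i\<in>{..d}. U i) = {0} \<or> span (\<Union>i\<in>{..d}. U i) = UNIV"
    using diagonal_span_trivial[of 0] by (simp add: U_def)
  moreover obtain x where x: "x \<in> eigenspace As (ts 0)" "x \<noteq> 0"
    using dual.nonzero[of 0] subspace_0[OF subspace_eigenspace[OF dual.lin_A]] by blast
  then have "x \<in> U 0"
    by (auto simp: U_def G_UNIV F_def intro: eigensum_base)
  then have "x \<in> span (\<Union>i\<in>{..d}. U i)"
    by (intro span_base) auto
  ultimately show ?thesis using x(2) by auto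
qed

text \<open>The case \<open>k = 0\<close> is directness of the split decomposition; for general \<open>k\<close> the statement says that \<open>F k\<close> is the
sum of the first \<open>k\<close> split components. Going down from \<open>h = d\<close>, once the later components are
zero, \<open>c h\<close> lies in \<open>F h\<close> as well as in \<open>G h\<close>.\<close>
lemma U_components_vanish:
  assumes c: "\<And>h. h \<le> d \<Longrightarrow> c h \<in> U h" and sum: "(\<Sum>h\<le>d. c h) \<in> F k" and h: "k \<le> h" "h \<le> d"
  shows "c h = 0"
proof -
  have "\<forall>h. k \<le> h \<longrightarrow> h \<le> d \<longrightarrow> d - h < n \<longrightarrow> c h = 0" for n
  proof (induction n)
    case (Suc n)
    show ?case
    proof (intro allI impI)
      fix h assume h: "k \<le> h" "h \<le> d" "d - h < Suc n"
      have "\<forall>i\<in>{..d} - insert h {..<h}. c i = 0"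
      proof
        fix i assume "i \<in> {..d} - insert h {..<h}"
        then have "h < i" "i \<le> d" by auto
        then have "k \<le> i" "d - i < n" using h by auto
        then show "c i = 0" using Suc.IH \<open>i \<le> d\<close> by blast
      qed
      then have "(\<Sum>i\<le>d. c i) = (\<Sum>i\<in>insert h {..<h}. c i)"
        using h(2) by (intro sum.mono_neutral_right) (simp_all add: subset_iff)
      then have "c h = (\<Sum>i\<le>d. c i) - (\<Sum>i<h. c i)"
        by simp
      moreover have "(\<Sum>i<h. c i) \<in> F h"
      proof (rule subspace_sum)
        fix i assume "i \<in> {..<h}"
        then show "c i \<in> F h"
          using c[of i] h(2) F_mono[of "Suc i" h] by (auto simp: U_def)
      qed simp
      moreover have "(\<Sum>i\<le>d. c i) \<in> F h"
        using sum F_mono[OF h(1)] by blast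
      ultimately have "c h \<in> F h" by (simp add: subspace_diff)
      then show "c h = 0"
        using F_meet_G[of h h "c h"] c[OF h(2)] by (simp add: U_def)
    qed
  qed simp
  from this[of "Suc d"] show ?thesis using h by auto
qed

lemma U_independent:
  assumes "\<And>h. h \<le> d \<Longrightarrow> c h \<in> U h" "(\<Sum>h\<le>d. c h) = 0" "h \<le> d"
  shows "c h = 0"
  using U_components_vanish[of c 0 h] assms by simp

section \<open>Raising and lowering between split components\<close>
lemma U_tau:
  assumes "i \<le> j" "j \<le> d" "x \<in> U i"
  shows "poly_apply (tau t i j) A x \<in> U j"
  using assms(1,2)
proof (induction j rule: dec_induct)
  case base
  then show ?case using assms by simp
next
  case (step j)
  then show ?case
    using A_F_shift[of _ "Suc j"] A_G[of _ j]
    by (simp add: poly_apply_tau_Suc chain.lin_A U_def)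
qed

lemma U_tau_dual:
  assumes "i \<le> j" "j \<le> d" "x \<in> U j"
  shows "poly_apply (tau ts (Suc i) (Suc j)) As x \<in> U i"
  using assms
proof (induction j arbitrary: x rule: dec_induct)
  case base
  then show ?case by simp
next
  case (step j)
  have "tau ts (Suc i) (Suc (Suc j)) = tau ts (Suc i) (Suc j) * [:- ts (Suc j), 1:]"
    using step.hyps by (intro tau_Suc) simp
  then have "poly_apply (tau ts (Suc i) (Suc (Suc j))) As x
      = poly_apply (tau ts (Suc i) (Suc j)) As (As x - ts (Suc j) *s x)"
    by (simp add: poly_apply_mult poly_apply_pCons dual.lin_A lin_0 del: mult_pCons_right)
  moreover have "As x - ts (Suc j) *s x \<in> U j"
    using step.prems As_F[of x "Suc j"] As_G_shift[of x "Suc j"] by (simp add: U_def)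
  ultimately show ?case using step by simp
qed

text \<open>This is the trivial intersection of flags for the reversed ordering of the eigenspaces of \<open>A\<close>.\<close>
lemma F_meet_initial:
  assumes "i + k \<le> Suc d" "x \<in> F i" "x \<in> eigensum A t {..<k}"
  shows "x = 0"
proof -
  interpret rev: tridiagonal_pair scale Basis d A As "\<lambda>i. t (d - i)" ts by (rule reverse)
  have "{..<k} \<subseteq> (\<lambda>i. d - i) ` {Suc d - k..d}"
  proof
    fix h assume "h \<in> {..<k}"
    then show "h \<in> (\<lambda>i. d - i) ` {Suc d - k..d}"
      using assms(1) by (intro image_eqI[of _ _ "d - h"]) auto
  qed
  then have "x \<in> rev.G (Suc d - k)"
    unfolding rev.G_def eigensum_reindex using assms(3) eigensum_mono by blast
  moreover have "x \<in> rev.F i" using assms(2) by (simp add: rev.F_def F_def)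
  ultimately show ?thesis
    using rev.F_meet_G[of i "Suc d - k" x] assms(1) by simp
qed

text \<open>This is the trivial intersection of flags for the reversed ordering of the eigenspaces of \<open>As\<close>.\<close>
lemma final_meet_G:
  assumes "k \<le> j" "k \<le> d" "x \<in> eigensum As ts {Suc d - k..d}" "x \<in> G j"
  shows "x = 0"
proof -
  interpret rev: tridiagonal_pair scale Basis d A As t "\<lambda>i. ts (d - i)" by (rule reverse_dual)
  have "{Suc d - k..d} \<subseteq> (\<lambda>i. d - i) ` {..<k}"
  proof
    fix h assume "h \<in> {Suc d - k..d}"
    then show "h \<in> (\<lambda>i. d - i) ` {..<k}"
      using assms(1,2) by (intro image_eqI[of _ _ "d - h"]) auto
  qed
  then have "x \<in> rev.F k"
    unfolding rev.F_def eigensum_reindex using assms(3) eigensum_mono by blast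
  moreover have "x \<in> rev.G j" using assms(4) by (simp add: rev.G_def G_def)
  ultimately show ?thesis
    using rev.F_meet_G[of k j x] assms(1) by simp
qed

text \<open>A vector of \<open>U i\<close> killed by \<open>tau t i j\<close> lies in the eigenspaces with indices below \<open>j\<close>, hence in an
intersection of opposite flags that is trivial as long as \<open>i + j \<le> d\<close>.\<close>
lemma tau_injective_on_U:
  assumes "i \<le> j" "i + j \<le> d" "x \<in> U i" "poly_apply (tau t i j) A x = 0"
  shows "x = 0"
proof (rule F_meet_initial)
  show "Suc i + j \<le> Suc d" using assms by simp
  show "x \<in> F (Suc i)" using assms by (simp add: U_def)
  have "{i..<j} \<subseteq> {..<j}" by auto
  then show "x \<in> eigensum A t {..<j}"
    using chain.in_eigensum_of_tau_zero[of i j x] assms eigensum_mono[of "{i..<j}" "{..<j}" A t]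
    by auto
qed

lemma tau_dual_injective_on_U:
  assumes "2 * i \<le> d" "x \<in> U (d - i)" "poly_apply (tau ts (Suc i) (Suc (d - i))) As x = 0"
  shows "x = 0"
proof (rule final_meet_G[of "d - i" "d - i"])
  show "x \<in> G (d - i)" using assms by (simp add: U_def)
  have "x \<in> eigensum As ts {Suc i..<Suc (d - i)}"
    using assms by (intro dual.in_eigensum_of_tau_zero) auto
  moreover have "{Suc i..<Suc (d - i)} \<subseteq> {Suc d - (d - i)..d}" using assms(1) by auto
  ultimately show "x \<in> eigensum As ts {Suc d - (d - i)..d}"
    using eigensum_mono by blast
qed auto

lemma mutual_injections_surjective:
  assumes f: "lin f" "f ` S \<subseteq> T" "\<And>x. x \<in> S \<Longrightarrow> f x = 0 \<Longrightarrow> x = 0"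
    and g: "lin g" "g ` T \<subseteq> S" "\<And>x. x \<in> T \<Longrightarrow> g x = 0 \<Longrightarrow> x = 0"
    and S: "subspace S" and T: "subspace T"
  shows "f ` S = T"
proof -
  interpret finite_dimensional_vector_space_pair_1 scale Basis scale by unfold_locales
  have inj: "inj_on h (span W)"
    if "lin h" "\<And>x. x \<in> W \<Longrightarrow> h x = 0 \<Longrightarrow> x = 0" "subspace W" for h W
  proof (rule inj_onI)
    fix x y assume "x \<in> span W" "y \<in> span W" "h x = h y"
    then have "x - y \<in> W" "h (x - y) = 0"
      using that by (auto simp: lin_diff subspace_diff span_eq_iff[THEN iffD2])
    then show "x = y" using that(2) by fastforce
  qed
  show ?thesis
  proof (rule subspace_dim_equal)
    show "subspace (f ` S)"
      using lin_span[OF f(1), of S] S by (metis span_eq_iff subspace_span)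
    have "dim T = dim (g ` T)" by (rule dim_image_eq[OF g(1) inj[OF g(1,3) T], symmetric])
    also have "\<dots> \<le> dim S" by (rule dim_subset[OF g(2)])
    also have "\<dots> = dim (f ` S)" by (rule dim_image_eq[OF f(1) inj[OF f(1,3) S], symmetric])
    finally show "dim T \<le> dim (f ` S)" .
  qed (fact T f(2))+
qed

text \<open>The products in \<open>A\<close> and in \<open>As\<close> inject \<open>U i\<close> and \<open>U (d - i)\<close> into one another, so in finite dimension both are
bijections.\<close>
lemma tau_surjective_on_U:
  assumes "2 * i \<le> d"
  shows "poly_apply (tau t i (d - i)) A ` U i = U (d - i)"
proof (rule mutual_injections_surjective)
  show "poly_apply (tau t i (d - i)) A ` U i \<subseteq> U (d - i)"
    using assms U_tau[of i "d - i"] by auto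
  show "poly_apply (tau ts (Suc i) (Suc (d - i))) As ` U (d - i) \<subseteq> U i"
    using assms U_tau_dual[of i "d - i"] by auto
  show "x = 0" if "x \<in> U i" "poly_apply (tau t i (d - i)) A x = 0" for x
    using tau_injective_on_U[of i "d - i" x] assms that by simp
  show "x = 0" if "x \<in> U (d - i)" "poly_apply (tau ts (Suc i) (Suc (d - i))) As x = 0" for x
    using tau_dual_injective_on_U assms that by blast
qed (simp_all add: poly_apply_lin chain.lin_A dual.lin_A)

lemma K_subset_U: "K i \<subseteq> U i"
  unfolding K_def U_def G_def using eigensum_mono[of "{i..d - i}" "{i..d}" A t] by auto

lemma K_eq_kernel:
  assumes "2 * i \<le> d" "x \<in> U i"
  shows "x \<in> K i \<longleftrightarrow> poly_apply (tau t i (Suc (d - i))) A x = 0"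
proof -
  have e: "{i..<Suc (d - i)} = {i..d - i}" by auto
  have "x \<in> eigensum A t {i..d - i} \<longleftrightarrow> poly_apply (tau t i (Suc (d - i))) A x = 0"
    using chain.in_eigensum_of_tau_zero[of i "Suc (d - i)" x]
      chain.tau_zero_of_eigensum[of x i "Suc (d - i)"] assms(1) unfolding e by auto
  then show ?thesis using assms(2) by (simp add: K_def U_def)
qed

lemma U_0: "U 0 = K 0"
  by (simp add: U_def K_def G_def)

text \<open>This is the step that produces the spaces \<open>K\<close>. Both \<open>x\<close> and the raised vectors from \<open>U i\<close> are mapped to \<open>U (d - i)\<close>
by the same product, and by surjectivity some \<open>w\<close> of \<open>U i\<close> reaches the image of \<open>x\<close>. The difference is killed, and
the kernel of that product on \<open>U (Suc i)\<close> is \<open>K (Suc i)\<close>.\<close>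
lemma U_Suc_decomposition:
  assumes i: "2 * Suc i \<le> d" and x: "x \<in> U (Suc i)"
  shows "\<exists>w\<in>U i. x - (A w - t i *s w) \<in> K (Suc i)"
proof -
  have e: "Suc (d - Suc i) = d - i" using i by simp
  have "poly_apply (tau t (Suc i) (d - i)) A x \<in> U (d - i)"
    using i x by (intro U_tau) auto
  then obtain w where w: "w \<in> U i"
    "poly_apply (tau t (Suc i) (d - i)) A x = poly_apply (tau t i (d - i)) A w"
    using tau_surjective_on_U[of i] i by (auto simp: image_iff)
  have "A w - t i *s w \<in> U (Suc i)"
    using U_tau[of i "Suc i" w] w(1) i by (simp add: poly_apply_tau_Suc chain.lin_A)
  then have "x - (A w - t i *s w) \<in> U (Suc i)"
    using x by (simp add: subspace_diff)
  moreover have "poly_apply (tau t (Suc i) (d - i)) A (x - (A w - t i *s w)) = 0"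
    using w(2) poly_apply_tau_front[OF chain.lin_A, of i "d - i" t w] i
    by (simp add: lin_diff[OF poly_apply_lin[OF chain.lin_A]])
  ultimately have "x - (A w - t i *s w) \<in> K (Suc i)"
    using K_eq_kernel[OF i, of "x - (A w - t i *s w)"] e by simp
  then show ?thesis using w(1) by blast
qed

section \<open>The refinement of the split decomposition by the spaces K\<close>
definition ladder :: "(nat \<times> nat) set" where
  "ladder = {(i, j). 2 * i \<le> d \<and> i \<le> j \<and> j \<le> d - i}"

lemma finite_ladder: "finite ladder"
  by (rule finite_subset[of _ "{..d} \<times> {..d}"]) (auto simp: ladder_def)

text \<open>These are the summands of the decomposition along the ladder that lie in \<open>U j\<close>.\<close>
definition rungs :: "nat \<Rightarrow> 'b set" where
  "rungs j = (\<Union>i\<in>{..min j (d - j)}. poly_apply (tau t i j) A ` K i)"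

lemma U_subset_span_rungs_low: "2 * j \<le> d \<Longrightarrow> U j \<subseteq> span (rungs j)"
proof (induction j)
  case 0
  have "K 0 \<subseteq> rungs 0" by (auto simp: rungs_def)
  then show ?case using span_superset by (auto simp: U_0)
next
  case (Suc j)
  show ?case
  proof
    fix x assume "x \<in> U (Suc j)"
    then obtain w where w: "w \<in> U j" and k: "x - (A w - t j *s w) \<in> K (Suc j)"
      using U_Suc_decomposition Suc.prems by blast
    define f where "f y = A y - t j *s y" for y
    have f: "lin f" unfolding f_def[abs_def] by (rule lin_minus_scalar[OF chain.lin_A])
    have "f ` rungs j \<subseteq> rungs (Suc j)"
    proof
      fix y assume "y \<in> f ` rungs j"
      then obtain i v where iv: "i \<le> j" "v \<in> K i" "y = f (poly_apply (tau t i j) A v)"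
        by (auto simp: rungs_def)
      then have "y = poly_apply (tau t i (Suc j)) A v"
        by (simp add: f_def poly_apply_tau_Suc chain.lin_A)
      then show "y \<in> rungs (Suc j)"
        using iv Suc.prems unfolding rungs_def by (intro UN_I[of i]) auto
    qed
    then have "f ` span (rungs j) \<subseteq> span (rungs (Suc j))"
      unfolding lin_span[OF f, symmetric] by (rule span_mono)
    then have "f w \<in> span (rungs (Suc j))"
      using w Suc by auto
    moreover have "x - f w \<in> rungs (Suc j)"
      unfolding rungs_def using k Suc.prems by (intro UN_I[of "Suc j"]) (auto simp: f_def)
    then have "x - f w \<in> span (rungs (Suc j))" by (rule span_base)
    ultimately have "(x - f w) + f w \<in> span (rungs (Suc j))"
      by (intro span_add)
    then show "x \<in> span (rungs (Suc j))" by simp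
  qed
qed

lemma U_subset_span_rungs:
  assumes "j \<le> d"
  shows "U j \<subseteq> span (rungs j)"
proof (cases "2 * j \<le> d")
  case True
  then show ?thesis by (rule U_subset_span_rungs_low)
next
  case False
  define m where "m = d - j"
  have m: "2 * m \<le> d" "m \<le> j" "j = d - m" "d - j = m" using assms False by (auto simp: m_def)
  define f where "f = poly_apply (tau t m j) A"
  have f: "lin f" by (simp add: f_def poly_apply_lin chain.lin_A)
  have "f ` rungs m \<subseteq> rungs j"
  proof
    fix y assume "y \<in> f ` rungs m"
    then obtain i v where iv: "i \<le> m" "v \<in> K i" "y = f (poly_apply (tau t i m) A v)"
      by (auto simp: rungs_def)
    then have "y = poly_apply (tau t i j) A v"
      using m poly_apply_tau_split[OF chain.lin_A, of i m j t v] by (simp add: f_def)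
    then show "y \<in> rungs j"
      using iv m unfolding rungs_def by (intro UN_I[of i]) auto
  qed
  then have "f ` span (rungs m) \<subseteq> span (rungs j)"
    unfolding lin_span[OF f, symmetric] by (rule span_mono)
  moreover have "U j = f ` U m"
    using tau_surjective_on_U[OF m(1)] m by (simp add: f_def)
  ultimately show ?thesis
    using U_subset_span_rungs_low[OF m(1)] by auto
qed

lemma span_ladder: "span (\<Union>(i, j)\<in>ladder. poly_apply (tau t i j) A ` K i) = UNIV" (is "span ?L = _")
proof -
  have "U j \<subseteq> span ?L" if "j \<le> d" for j
  proof -
    have "rungs j \<subseteq> ?L"
    proof
      fix y assume "y \<in> rungs j"
      then obtain i where i: "i \<le> min j (d - j)" "y \<in> poly_apply (tau t i j) A ` K i"
        unfolding rungs_def by blast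
      then have "(i, j) \<in> ladder" using that by (auto simp: ladder_def)
      then show "y \<in> ?L" using i(2) by blast
    qed
    then show ?thesis by (rule order_trans[OF U_subset_span_rungs[OF that] span_mono])
  qed
  then have "span (\<Union>j\<in>{..d}. U j) \<subseteq> span ?L"
    by (intro span_minimal) auto
  then show ?thesis using span_U by auto
qed

text \<open>The sum of the terms with index at most \<open>m\<close> is obtained by raising some \<open>w\<close> in \<open>U m\<close>. The product that kills
\<open>K (Suc m)\<close>, applied after this raising step, is injective on \<open>U m\<close>; so \<open>w = 0\<close>, and the induction continues
one level below.\<close>
lemma rungs_independent_low:
  assumes "2 * m \<le> d" "\<And>i. i \<le> m \<Longrightarrow> c i \<in> K i"
    and "(\<Sum>i\<le>m. poly_apply (tau t i m) A (c i)) = 0" "i \<le> m"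
  shows "c i = 0"
  using assms
proof (induction m arbitrary: i)
  case 0
  then show ?case by simp
next
  case (Suc m)
  define w where "w = (\<Sum>i\<le>m. poly_apply (tau t i m) A (c i))"
  have w: "w \<in> U m"
    unfolding w_def using Suc.prems(1,2) K_subset_U
    by (intro subspace_sum U_tau) (auto simp: le_Suc_eq)
  have pl: "lin (poly_apply p A)" for p by (rule poly_apply_lin[OF chain.lin_A])
  have "(\<Sum>i\<le>m. poly_apply (tau t i (Suc m)) A (c i)) = poly_apply (tau t m (Suc m)) A w"
    unfolding w_def lin_sum[OF pl]
    by (intro sum.cong poly_apply_tau_split chain.lin_A) auto
  then have s: "poly_apply (tau t m (Suc m)) A w + c (Suc m) = 0"
    using Suc.prems(3) by simp
  have e: "Suc (d - Suc m) = d - m" using Suc.prems(1) by simp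
  have cK: "c (Suc m) \<in> K (Suc m)" using Suc.prems(2) by simp
  then have "poly_apply (tau t (Suc m) (d - m)) A (c (Suc m)) = 0"
    using K_eq_kernel[OF Suc.prems(1), of "c (Suc m)"] K_subset_U e by auto
  then have "poly_apply (tau t (Suc m) (d - m)) A (poly_apply (tau t m (Suc m)) A w) = 0"
    using arg_cong[OF s, of "poly_apply (tau t (Suc m) (d - m)) A"] lin_0[OF pl]
    by (simp add: lin_add[OF pl])
  then have "poly_apply (tau t m (d - m)) A w = 0"
    using poly_apply_tau_split[OF chain.lin_A, of m "Suc m" "d - m" t w] Suc.prems(1) by simp
  then have "w = 0"
    using tau_injective_on_U[of m "d - m" w] w Suc.prems(1) by simp
  then have "c i = 0" if "i \<le> m" for i
    using Suc.IH[of i] Suc.prems that by (simp add: w_def)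
  moreover have "c (Suc m) = 0"
    using s \<open>w = 0\<close> lin_0[OF pl] by simp
  ultimately show ?case using Suc.prems(4) by (auto simp: le_Suc_eq)
qed

lemma rungs_independent:
  assumes "j \<le> d" "\<And>i. i \<le> min j (d - j) \<Longrightarrow> c i \<in> K i"
    and "(\<Sum>i\<le>min j (d - j). poly_apply (tau t i j) A (c i)) = 0" "i \<le> min j (d - j)"
  shows "c i = 0"
proof -
  define m where "m = min j (d - j)"
  have m: "2 * m \<le> d" "m \<le> j" "m + j \<le> d" using assms(1) by (auto simp: m_def)
  define w where "w = (\<Sum>i\<le>m. poly_apply (tau t i m) A (c i))"
  have w: "w \<in> U m"
    unfolding w_def using m assms(2) K_subset_U
    by (intro subspace_sum U_tau) (auto simp: m_def)
  have "poly_apply (tau t m j) A w = (\<Sum>i\<le>m. poly_apply (tau t i j) A (c i))"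
    unfolding w_def lin_sum[OF poly_apply_lin[OF chain.lin_A]]
    using m by (intro sum.cong poly_apply_tau_split[symmetric] chain.lin_A) auto
  also have "\<dots> = 0" using assms(3) by (simp add: m_def)
  finally have "w = 0" using tau_injective_on_U m w by blast
  then show ?thesis
    using rungs_independent_low[OF m(1), of c i] assms(2,4) by (simp add: w_def m_def)
qed

lemma ladder_independent:
  assumes c: "\<And>p. p \<in> ladder \<Longrightarrow> c p \<in> K (fst p)"
    and sum0: "(\<Sum>p\<in>ladder. poly_apply (tau t (fst p) (snd p)) A (c p)) = 0" and p: "p \<in> ladder"
  shows "c p = 0"
proof -
  define u where "u j = (\<Sum>i\<le>min j (d - j). poly_apply (tau t i j) A (c (i, j)))" for j
  have in_ladder: "(i, j) \<in> ladder" if "j \<le> d" "i \<le> min j (d - j)" for i j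
    using that by (auto simp: ladder_def)
  have "u j \<in> U j" if "j \<le> d" for j
    unfolding u_def
  proof (intro subspace_sum subspaces U_tau)
    fix i assume "i \<in> {..min j (d - j)}"
    then show "c (i, j) \<in> U i"
      using c[OF in_ladder, of j i] K_subset_U that by auto
  qed (use that in auto)
  moreover have "(\<Sum>j\<le>d. u j) = 0"
  proof -
    have "(\<Sum>j\<le>d. u j) = (\<Sum>(j, i)\<in>(SIGMA j:{..d}. {..min j (d - j)}).
        poly_apply (tau t i j) A (c (i, j)))"
      unfolding u_def by (rule sum.Sigma) auto
    also have "\<dots> = (\<Sum>p\<in>ladder. poly_apply (tau t (fst p) (snd p)) A (c p))"
      by (rule sum.reindex_bij_witness[of _ "\<lambda>(i, j). (j, i)" "\<lambda>(j, i). (i, j)"])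
        (auto simp: ladder_def)
    finally show ?thesis using sum0 by simp
  qed
  ultimately have "u j = 0" if "j \<le> d" for j
    using U_independent that by blast
  moreover obtain i j where ij: "p = (i, j)" "j \<le> d" "i \<le> min j (d - j)"
    using p by (cases p) (auto simp: ladder_def)
  ultimately show ?thesis
    using rungs_independent[of j "\<lambda>i. c (i, j)" i] c[OF in_ladder] by (simp add: u_def)
qed

end

section \<open>Lowering chains, split projections and standard orderings\<close>

context td_space
begin

text \<open>Once \<open>k > j - i\<close> the product contains the factor \<open>w i - w i\<close>, so the truncated index \<open>j - k\<close> is harmless.\<close>
lemma lowering_chain_power:
  assumes P: "lin P"
    and step: "\<And>j. i \<le> j \<Longrightarrow> j \<le> M \<Longrightarrow> P (x j) = (w j - w i) *s x (j - 1)"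
    and j: "i \<le> j" "j \<le> M"
  shows "(P ^^ k) (x j) = (\<Prod>h<k. w (j - h) - w i) *s x (j - k)"
proof (induction k)
  case 0
  then show ?case by simp
next
  case (Suc k)
  have "(P ^^ Suc k) (x j) = (\<Prod>h<k. w (j - h) - w i) *s P (x (j - k))"
    using Suc P by (simp add: lin_scale)
  also have "\<dots> = (\<Prod>h<Suc k. w (j - h) - w i) *s x (j - Suc k)"
  proof (cases "i \<le> j - k")
    case True
    then show ?thesis using step[of "j - k"] j by simp
  next
    case False
    then have "(\<Prod>h<k. w (j - h) - w i) = 0"
      using j by (intro prod_zero) (auto intro!: bexI[of _ "j - i"])
    then show ?thesis
      unfolding prod.lessThan_Suc by (simp only: mult_zero_left scale_zero_left)
  qed
  finally show ?case .
qed

text \<open>A map that lowers the vectors \<open>tau \<theta> i j (A) v\<close> with factors \<open>w j - w i\<close> turns the polynomial identity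
between the two Newton bases into an identity between vectors. The same coefficients serve for
all \<open>i\<close>, which is what makes the result one polynomial in \<open>P\<close>.\<close>
lemma lowering_chain_series:
  assumes A: "lin A" and P: "lin P"
    and step: "\<And>j. i \<le> j \<Longrightarrow> j \<le> M \<Longrightarrow>
      P (poly_apply (tau \<theta> i j) A v) = (w j - w i) *s poly_apply (tau \<theta> i (j - 1)) A v"
    and a0: "a 0 = 1"
    and a: "\<And>k j. k \<le> j \<Longrightarrow> j < d \<Longrightarrow>
      a (Suc k) * (w (Suc j) - w (j - k)) = a k * (\<theta> (j - k) - \<phi> j)"
    and j: "i \<le> j" "j \<le> M" "j \<le> d"
  shows "poly_apply (tau \<phi> i j) A v = (\<Sum>k=0..d. a k *s (P ^^ k) (poly_apply (tau \<theta> i j) A v))"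
proof -
  define x where "x j = poly_apply (tau \<theta> i j) A v" for j
  define q where "q k = (\<Prod>h<k. w (j - h) - w i)" for k
  have "tau \<phi> i j = (\<Sum>k=0..j - i. smult (a k * q k) (tau \<theta> i (j - k)))"
    unfolding q_def
    by (rule tau_change_of_base[where a = a and w = w and \<theta> = \<theta> and \<phi> = \<phi>, OF a0 _ j(1,3)])
      (rule a)
  then have "poly_apply (tau \<phi> i j) A v = (\<Sum>k=0..j - i. (a k * q k) *s x (j - k))"
    by (simp add: poly_apply_sum poly_apply_smult x_def)
  also have "\<dots> = (\<Sum>k=0..d. (a k * q k) *s x (j - k))"
  proof (rule sum.mono_neutral_left)
    show "\<forall>k\<in>{0..d} - {0..j - i}. (a k * q k) *s x (j - k) = 0"
    proof
      fix k assume "k \<in> {0..d} - {0..j - i}"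
      then have "j - i < k" by auto
      then have "q k = 0"
        unfolding q_def using j by (intro prod_zero) (auto intro!: bexI[of _ "j - i"])
      then show "(a k * q k) *s x (j - k) = 0" by simp
    qed
  qed (use j in auto)
  also have "\<dots> = (\<Sum>k=0..d. a k *s (P ^^ k) (x j))"
    using lowering_chain_power[OF P, of i M x w j] step j by (simp add: q_def x_def)
  finally show ?thesis by (simp add: x_def)
qed

lemma split_projection_properties:
  assumes W: "\<And>h. h \<le> d \<Longrightarrow> subspace (W h)" and spanning: "span (\<Union>h\<in>{..d}. W h) = UNIV"
    and independent: "\<forall>c. (\<forall>h\<le>d. c h \<in> W h) \<longrightarrow> (\<Sum>h\<le>d. c h) = 0 \<longrightarrow> (\<forall>h\<le>d. c h = 0)"
    and i: "i \<le> d"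
  shows "lin (split_projection d W i)"
    and "v \<in> W i \<Longrightarrow> split_projection d W i v = v"
    and "j \<le> d \<Longrightarrow> j \<noteq> i \<Longrightarrow> v \<in> W j \<Longrightarrow> split_projection d W i v = 0"
proof -
  have "\<exists>!P. lin P \<and> (\<forall>h\<in>{..d}. \<forall>v\<in>W h. P v = (if h = i then v else 0))"
    by (rule unique_linear_extension[where T = "\<lambda>_ v. v"])
      (use W spanning independent in \<open>auto intro!: linI\<close>)
  moreover have "(\<lambda>P. lin P \<and> (\<forall>h\<in>{..d}. \<forall>v\<in>W h. P v = (if h = i then v else 0)))
      = (\<lambda>P. lin P \<and> (\<forall>v\<in>W i. P v = v) \<and> (\<forall>j\<le>d. j \<noteq> i \<longrightarrow> (\<forall>v\<in>W j. P v = 0)))"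
    using i by (auto simp: fun_eq_iff)
  ultimately have "\<exists>!P. lin P \<and> (\<forall>v\<in>W i. P v = v) \<and> (\<forall>j\<le>d. j \<noteq> i \<longrightarrow> (\<forall>v\<in>W j. P v = 0))"
    by simp
  from theI'[OF this] show "lin (split_projection d W i)"
    "v \<in> W i \<Longrightarrow> split_projection d W i v = v"
    "j \<le> d \<Longrightarrow> j \<noteq> i \<Longrightarrow> v \<in> W j \<Longrightarrow> split_projection d W i v = 0"
    unfolding split_projection_def by blast+
qed

text \<open>This passes from the definition by orderings of eigenspaces to the description by eigenvalue
sequences. The basis of eigenvectors makes the eigenspaces of the ordering span the space.\<close>
lemma chain_of_standard_ordering:
  assumes A: "lin A" and B: "lin B" and diag: "diagonalizable A"
    and std: "standard_ordering A B d (\<lambda>i. range (E i))"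
  shows "tridiagonal_chain scale d A B (eigenvalue A E)"
    and "\<And>i. i \<le> d \<Longrightarrow> range (E i) = eigenspace A (eigenvalue A E i)"
proof -
  let ?t = "eigenvalue A E"
  have bij: "bij_betw (\<lambda>i. range (E i)) {0..d} (eigenspaces A)"
    and tri: "\<And>i. i \<le> d \<Longrightarrow> B ` range (E i) \<subseteq>
        (if i = 0 then 0 else range (E (i - 1))) + range (E i) + (if i = d then 0 else range (E (i + 1)))"
    using std by (auto simp: standard_ordering_def)
  have ev: "range (E i) = eigenspace A (?t i) \<and> range (E i) \<noteq> {0}" if "i \<le> d" for i
  proof -
    have "range (E i) \<in> eigenspaces A"
      using bij_betwE[OF bij] that by simp
    then obtain s where s: "range (E i) = eigenspace A s" "range (E i) \<noteq> {0}"
      unfolding eigenspaces_def by blast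
    have "0 \<in> range (E i)" using s subspace_0[OF subspace_eigenspace[OF A]] by simp
    then obtain v where v: "v \<in> range (E i)" "v \<noteq> 0" using s(2) by blast
    have "?t i = s"
      unfolding eigenvalue_def
    proof (rule the_equality)
      show "\<forall>v\<in>range (E i). A v = s *s v" unfolding s(1) by (simp add: eigenspace_def)
      fix r assume "\<forall>v\<in>range (E i). A v = r *s v"
      then have "r *s v = s *s v" using v s(1) by (auto simp: eigenspace_def)
      then show "r = s" using v(2) by simp
    qed
    then show ?thesis using s by simp
  qed
  then show r: "\<And>i. i \<le> d \<Longrightarrow> range (E i) = eigenspace A (?t i)" by blast
  show "tridiagonal_chain scale d A B ?t"
  proof (intro tridiagonal_chain.intro tridiagonal_chain_axioms.intro td_space_axioms A B)
    show "inj_on ?t {..d}"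
    proof (rule inj_onI)
      fix i j assume "i \<in> {..d}" "j \<in> {..d}" "?t i = ?t j"
      then have "range (E i) = range (E j)" using r by simp
      then show "i = j"
        using inj_onD[OF bij_betw_imp_inj_on[OF bij], of i j] \<open>i \<in> {..d}\<close> \<open>j \<in> {..d}\<close> by simp
    qed
    show "eigensum A ?t {..d} = UNIV"
    proof -
      obtain Bs where Bs: "independent Bs" "span Bs = UNIV" "\<forall>b\<in>Bs. \<exists>t. A b = t *s b"
        using diag unfolding diagonalizable_def by blast
      have "Bs \<subseteq> eigensum A ?t {..d}"
      proof
        fix b assume b: "b \<in> Bs"
        then obtain s where s: "b \<in> eigenspace A s" using Bs(3) by (auto simp: eigenspace_def)
        have "b \<noteq> 0" using Bs(1) b dependent_zero by blast
        then have "eigenspace A s \<in> eigenspaces A" using s unfolding eigenspaces_def by blast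
        then have "eigenspace A s \<in> (\<lambda>i. range (E i)) ` {0..d}"
          using bij_betw_imp_surj_on[OF bij] by simp
        then obtain i where "i \<le> d" "eigenspace A s = range (E i)" by auto
        then show "b \<in> eigensum A ?t {..d}"
          using s r by (intro eigensum_base[of b A ?t i]) auto
      qed
      then show ?thesis using span_minimal[of Bs "eigensum A ?t {..d}"] Bs(2) by auto
    qed
    show "eigenspace A (?t i) \<noteq> {0}" if "i \<le> d" for i
      using ev[OF that] by metis
    show "B x \<in> eigensum A ?t ({i - 1..i + 1} \<inter> {..d})" (is "_ \<in> ?S")
      if i: "i \<le> d" and x: "x \<in> eigenspace A (?t i)" for i x
    proof -
      have sub: "range (E k) \<subseteq> ?S" if "k \<in> {i - 1..i + 1}" "k \<le> d" for k
        using r[OF that(2)] that by (auto intro: eigensum_base)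
      have 0: "0 \<in> ?S" by (rule subspace_0) simp
      have "B x \<in> (if i = 0 then 0 else range (E (i - 1))) + range (E i)
          + (if i = d then 0 else range (E (i + 1)))"
        using tri[OF i] x r[OF i] by blast
      then obtain a b c where "B x = a + b + c"
        "a \<in> (if i = 0 then 0 else range (E (i - 1)))" "b \<in> range (E i)"
        "c \<in> (if i = d then 0 else range (E (i + 1)))"
        unfolding set_plus_def by blast
      moreover have "(if i = 0 then 0 else range (E (i - 1))) \<subseteq> ?S"
        using sub[of "i - 1"] i 0 by (auto simp: set_zero)
      moreover have "(if i = d then 0 else range (E (i + 1))) \<subseteq> ?S"
        using sub[of "i + 1"] i 0 by (auto simp: set_zero)
      moreover have "range (E i) \<subseteq> ?S"
        using sub[of i] i by auto
      ultimately show ?thesis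
        by (auto intro!: subspace_add)
    qed
  qed
qed

end

section \<open>The maps Delta and Psi of a tridiagonal system\<close>
locale tridiagonal_system = tridiagonal_pair scale Basis d A As t ts
  for scale :: "'a::field \<Rightarrow> 'b::ab_group_add \<Rightarrow> 'b" (infixr \<open>*s\<close> 75)
    and Basis d A As t ts +
  fixes E Es :: "nat \<Rightarrow> 'b \<Rightarrow> 'b"
  assumes range_E: "i \<le> d \<Longrightarrow> range (E i) = eigenspace A (t i)"
    and range_Es: "i \<le> d \<Longrightarrow> range (Es i) = eigenspace As (ts i)"
    and t_eq: "t = eigenvalue A E"
begin

abbreviation rev_t :: "nat \<Rightarrow> 'a" where "rev_t \<equiv> \<lambda>h. t (d - h)"

sublocale rev: tridiagonal_pair scale Basis d A As rev_t ts
  by (rule reverse)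

lemma sum_range_E:
  assumes "finite I" "I \<subseteq> {..d}"
  shows "(\<Sum>h\<in>I. range (E h)) = eigensum A t I"
proof -
  have "(\<Sum>h\<in>I. range (E h)) = (\<Sum>h\<in>I. eigenspace A (t h))"
    using assms by (intro sum.cong refl range_E) auto
  then show ?thesis
    using assms(1) by (simp add: sum_subspaces_eq_span subspace_eigenspace chain.lin_A eigensum_def)
qed

lemma sum_range_Es:
  assumes "finite I" "I \<subseteq> {..d}"
  shows "(\<Sum>h\<in>I. range (Es h)) = eigensum As ts I"
proof -
  have "(\<Sum>h\<in>I. range (Es h)) = (\<Sum>h\<in>I. eigenspace As (ts h))"
    using assms by (intro sum.cong refl range_Es) auto
  then show ?thesis
    using assms(1) by (simp add: sum_subspaces_eq_span subspace_eigenspace dual.lin_A eigensum_def)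
qed

lemma F_Suc: "i \<le> d \<Longrightarrow> (\<Sum>h=0..i. range (Es h)) = F (Suc i)"
  using sum_range_Es[of "{0..i}"] by (simp add: F_def lessThan_Suc_atMost atLeast0AtMost)

lemma split_U_eq: "i \<le> d \<Longrightarrow> split_U d E Es i = U i"
  unfolding split_U_def by (simp add: F_Suc U_def G_def sum_range_E)

lemma split_U_down_eq:
  assumes "i \<le> d"
  shows "split_U_down d E Es i = rev.U i"
proof -
  have "(\<lambda>h. d - h) ` {i..d} = {0..d - i}"
  proof (intro subset_antisym subsetI)
    fix h assume "h \<in> {0..d - i}"
    then show "h \<in> (\<lambda>h. d - h) ` {i..d}"
      using assms by (intro image_eqI[of _ _ "d - h"]) auto
  qed (use assms in auto)
  then have "rev.G i = eigensum A t {0..d - i}"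
    by (simp add: rev.G_def eigensum_reindex)
  then show ?thesis
    unfolding split_U_down_def using assms by (simp add: F_Suc rev.U_def rev.F_def F_def sum_range_E)
qed

lemma K_space_eq: "2 * i \<le> d \<Longrightarrow> K_space d E Es i = K i"
  unfolding K_space_def by (simp add: F_Suc K_def sum_range_E)

lemma
  assumes i: "i \<le> d"
  shows lin_split_projection: "lin (split_projection d (split_U d E Es) i)"
    and split_projection_same: "v \<in> U i \<Longrightarrow> split_projection d (split_U d E Es) i v = v"
    and split_projection_other: "j \<le> d \<Longrightarrow> j \<noteq> i \<Longrightarrow> v \<in> U j \<Longrightarrow> split_projection d (split_U d E Es) i v = 0"
proof -
  have W: "subspace (split_U d E Es h)" if "h \<le> d" for h
    using that by (simp add: split_U_eq)
  have spn: "span (\<Union>h\<in>{..d}. split_U d E Es h) = UNIV"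
    using span_U by (simp add: split_U_eq)
  have ind: "\<forall>c. (\<forall>h\<le>d. c h \<in> split_U d E Es h) \<longrightarrow> (\<Sum>h\<le>d. c h) = 0
      \<longrightarrow> (\<forall>h\<le>d. c h = 0)"
    using U_independent split_U_eq by (metis (no_types, lifting))
  note * = split_projection_properties[OF W spn ind i]
  show "lin (split_projection d (split_U d E Es) i)" by (rule *(1))
  show "split_projection d (split_U d E Es) i v = v" if "v \<in> U i"
    using *(2)[of v] that i by (simp add: split_U_eq)
  show "split_projection d (split_U d E Es) i v = 0" if "j \<le> d" "j \<noteq> i" "v \<in> U j"
    using *(3)[of j v] that by (simp add: split_U_eq)
qed

lemma
  assumes i: "i \<le> d"
  shows lin_split_projection_down: "lin (split_projection d (split_U_down d E Es) i)"
    and split_projection_down_same: "v \<in> rev.U i \<Longrightarrow> split_projection d (split_U_down d E Es) i v = v"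
    and split_projection_down_other:
      "j \<le> d \<Longrightarrow> j \<noteq> i \<Longrightarrow> v \<in> rev.U j \<Longrightarrow> split_projection d (split_U_down d E Es) i v = 0"
proof -
  have W: "subspace (split_U_down d E Es h)" if "h \<le> d" for h
    using that by (simp add: split_U_down_eq)
  have spn: "span (\<Union>h\<in>{..d}. split_U_down d E Es h) = UNIV"
    using rev.span_U by (simp add: split_U_down_eq)
  have ind: "\<forall>c. (\<forall>h\<le>d. c h \<in> split_U_down d E Es h) \<longrightarrow> (\<Sum>h\<le>d. c h) = 0
      \<longrightarrow> (\<forall>h\<le>d. c h = 0)"
    using rev.U_independent split_U_down_eq by (metis (no_types, lifting))
  note * = split_projection_properties[OF W spn ind i]
  show "lin (split_projection d (split_U_down d E Es) i)" by (rule *(1))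
  show "split_projection d (split_U_down d E Es) i v = v" if "v \<in> rev.U i"
    using *(2)[of v] that i by (simp add: split_U_down_eq)
  show "split_projection d (split_U_down d E Es) i v = 0" if "j \<le> d" "j \<noteq> i" "v \<in> rev.U j"
    using *(3)[of j v] that by (simp add: split_U_down_eq)
qed

lemma split_projection_down_F:
  assumes j: "j \<le> d" and z: "z \<in> F j"
  shows "split_projection d (split_U_down d E Es) j z = 0"
proof -
  have "z \<in> span (\<Union>h\<in>{..d}. rev.U h)" by (simp add: rev.span_U)
  then obtain c where c: "\<And>h. h \<le> d \<Longrightarrow> c h \<in> rev.U h" and zc: "z = (\<Sum>h\<le>d. c h)"
    by (subst (asm) span_UN_iff) auto
  have "c j = 0"
    using rev.U_components_vanish[of c j j] c zc z j by (simp add: F_def rev.F_def)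
  have "split_projection d (split_U_down d E Es) j z
      = (\<Sum>h\<le>d. split_projection d (split_U_down d E Es) j (c h))"
    unfolding zc by (rule lin_sum[OF lin_split_projection_down[OF j]])
  also have "\<dots> = 0"
  proof (rule sum.neutral, rule ballI)
    fix h assume "h \<in> {..d}"
    then show "split_projection d (split_U_down d E Es) j (c h) = 0"
      using split_projection_down_other[OF j, of h "c h"] c[of h] \<open>c j = 0\<close>
        lin_0[OF lin_split_projection_down[OF j]]
      by (cases "h = j") auto
  qed
  finally show ?thesis .
qed

lemma lin_Delta: "lin (Delta d E Es)"
  by (rule linI)
    (simp_all add: Delta_def lin_add[OF lin_split_projection] lin_add[OF lin_split_projection_down]
      lin_scale[OF lin_split_projection] lin_scale[OF lin_split_projection_down]
      sum.distrib scale_sum_right)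

text \<open>On \<open>U j\<close> the map \<Delta> is the projection to the \<open>j\<close>-th component of the second split decomposition, and that
projection kills \<open>F j\<close>. So \<Delta> sends \<open>x\<close> to the only vector of the second component that agrees with \<open>x\<close> modulo
\<open>F j\<close>.\<close>
lemma Delta_U:
  assumes j: "j \<le> d" and x: "x \<in> U j" and y: "y \<in> rev.U j" and xy: "x - y \<in> F j"
  shows "Delta d E Es x = y"
proof -
  let ?P = "split_projection d (split_U d E Es)" and ?Q = "split_projection d (split_U_down d E Es)"
  have "Delta d E Es x = (\<Sum>h\<in>{0..d}. if h = j then ?Q j x else 0)"
    unfolding Delta_def
  proof (rule sum.cong)
    fix h assume h: "h \<in> {0..d}"
    then show "?Q h (?P h x) = (if h = j then ?Q j x else 0)"
      using x j split_projection_same[of h x] split_projection_other[of h j x]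
        lin_0[OF lin_split_projection_down, of h]
      by auto
  qed simp
  also have "\<dots> = ?Q j x" using j by simp
  also have "?Q j x = ?Q j (x - y) + ?Q j y"
    using lin_add[OF lin_split_projection_down[OF j], of "x - y" y] by simp
  also have "\<dots> = y"
    using split_projection_down_F[OF j xy] split_projection_down_same[OF j y] by simp
  finally show ?thesis .
qed

lemma K_subset_rev_U: "K i \<subseteq> rev.U i"
proof -
  have "{i..d - i} \<subseteq> (\<lambda>h. d - h) ` {i..d}"
  proof
    fix h assume "h \<in> {i..d - i}"
    then show "h \<in> (\<lambda>h. d - h) ` {i..d}" by (intro image_eqI[of _ _ "d - h"]) auto
  qed
  then show ?thesis
    unfolding K_def rev.U_def rev.G_def eigensum_reindex rev.F_def F_def
    using eigensum_mono by blast
qed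

text \<open>For \<open>v\<close> in \<open>K i\<close> the two products are monic of the same degree \<open>j - i\<close> in \<open>A\<close>, so they agree modulo \<open>F j\<close>, and they lie
in the \<open>j\<close>-th components of the first and the second split decomposition respectively.\<close>
lemma Delta_ladder:
  assumes ij: "(i, j) \<in> ladder" and v: "v \<in> K i"
  shows "Delta d E Es (poly_apply (tau t i j) A v) = poly_apply (tau rev_t i j) A v"
proof (rule Delta_U)
  have le: "i \<le> j" "j \<le> d" using ij by (auto simp: ladder_def)
  show "j \<le> d" by (rule le)
  have x: "poly_apply (tau t i k) A v \<in> U k" if "i \<le> k" "k \<le> d" for k
    using that v K_subset_U by (intro U_tau) auto
  have y: "poly_apply (tau rev_t i k) A v \<in> rev.U k" if "i \<le> k" "k \<le> d" for k
    using that v K_subset_rev_U by (intro rev.U_tau) auto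
  show "poly_apply (tau t i j) A v \<in> U j" by (rule x[OF le])
  show "poly_apply (tau rev_t i j) A v \<in> rev.U j" by (rule y[OF le])
  show "poly_apply (tau t i j) A v - poly_apply (tau rev_t i j) A v \<in> F j"
    using le
  proof (induction j rule: dec_induct)
    case base
    then show ?case by (simp add: subspace_0)
  next
    case (step k)
    let ?x = "poly_apply (tau t i k) A v" and ?y = "poly_apply (tau rev_t i k) A v"
    have "A (?x - ?y) \<in> F (Suc k)"
      using step by (intro A_F) auto
    moreover have "?x \<in> F (Suc k)"
      using x[of k] step by (simp add: U_def)
    moreover have "?y \<in> F (Suc k)"
      using y[of k] step by (simp add: rev.U_def rev.F_def F_def)
    ultimately have "A (?x - ?y) - t k *s ?x + rev_t k *s ?y \<in> F (Suc k)"
      by (intro subspace_add subspace_diff subspace_scale subspaces)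
    moreover have "poly_apply (tau t i (Suc k)) A v - poly_apply (tau rev_t i (Suc k)) A v
        = A (?x - ?y) - t k *s ?x + rev_t k *s ?y"
      using step.hyps by (simp add: poly_apply_tau_Suc chain.lin_A lin_diff)
    ultimately show ?case by simp
  qed
qed

text \<open>The direct sum decomposition along the ladder is what makes \<Psi> well defined.\<close>
lemma
  shows lin_Psi: "lin (Psi d A E Es)"
    and Psi_ladder: "(i, j) \<in> ladder \<Longrightarrow> v \<in> K i \<Longrightarrow>
      Psi d A E Es (poly_apply (tau t i j) A v)
        = (vartheta d t j - vartheta d t i) *s poly_apply (tau t i (j - 1)) A v"
proof -
  define S where "S p v = (vartheta d t (snd p) - vartheta d t (fst p))
      *s poly_apply (tau t (fst p) (snd p - 1)) A v" for p :: "nat \<times> nat" and v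
  have pl: "lin (poly_apply p A)" for p by (rule poly_apply_lin[OF chain.lin_A])
  have spn: "span (\<Union>p\<in>ladder. poly_apply (tau t (fst p) (snd p)) A ` K (fst p)) = UNIV"
    using span_ladder by (simp add: case_prod_unfold)
  have "\<exists>!P. lin P \<and>
      (\<forall>p\<in>ladder. \<forall>v\<in>K (fst p). P (poly_apply (tau t (fst p) (snd p)) A v) = S p v)"
  proof (rule unique_linear_extension[OF finite_ladder _ pl _ spn])
    show "lin (S p)" for p
      unfolding S_def[abs_def]
      by (rule linI) (simp_all add: lin_add[OF pl] lin_scale[OF pl] scale_right_distrib mult.commute)
  qed (use ladder_independent in auto)
  moreover have "(\<lambda>P. lin P \<and>
      (\<forall>p\<in>ladder. \<forall>v\<in>K (fst p). P (poly_apply (tau t (fst p) (snd p)) A v) = S p v))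
    = (\<lambda>P. lin P \<and> (\<forall>i j. 2 * i \<le> d \<longrightarrow> i \<le> j \<longrightarrow> j \<le> d - i \<longrightarrow>
        (\<forall>v\<in>K_space d E Es i. P (poly_apply (tau t i j) A v)
          = (vartheta d t j - vartheta d t i) *s poly_apply (tau t i (j - 1)) A v)))"
    by (auto simp: fun_eq_iff ladder_def S_def K_space_eq)
  ultimately have ex1: "\<exists>!P. lin P \<and> (\<forall>i j. 2 * i \<le> d \<longrightarrow> i \<le> j \<longrightarrow> j \<le> d - i \<longrightarrow>
        (\<forall>v\<in>K_space d E Es i. P (poly_apply (tau t i j) A v)
          = (vartheta d t j - vartheta d t i) *s poly_apply (tau t i (j - 1)) A v))"
    by simp
  note Psi = theI'[OF ex1, unfolded t_eq, folded Psi_def[unfolded Let_def], folded t_eq]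
  show "lin (Psi d A E Es)" using Psi by blast
  show "Psi d A E Es (poly_apply (tau t i j) A v)
        = (vartheta d t j - vartheta d t i) *s poly_apply (tau t i (j - 1)) A v"
    if "(i, j) \<in> ladder" "v \<in> K i"
    using Psi that by (auto simp: ladder_def K_space_eq)
qed

section \<open>Delta and its inverse as polynomials in Psi\<close>
context
  fixes \<beta> \<gamma> :: 'a
  assumes rec: "recurrent \<beta> \<gamma> d t"
    and nz: "\<And>i. 1 \<le> i \<Longrightarrow> i \<le> d \<Longrightarrow> vartheta d t i \<noteq> 0"
begin

lemma Delta_series:
  "Delta d E Es = (\<lambda>v. \<Sum>k=0..d. newton_coeff d t k *s (Psi d A E Es ^^ k) v)"
proof (rule lin_eqI[OF lin_Delta _ span_ladder])
  show "lin (\<lambda>v. \<Sum>k=0..d. newton_coeff d t k *s (Psi d A E Es ^^ k) v)"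
    by (rule lin_lincomb) (rule lin_funpow[OF lin_Psi])
  fix x assume "x \<in> (\<Union>(i, j)\<in>ladder. poly_apply (tau t i j) A ` K i)"
  then obtain i j v where ij: "(i, j) \<in> ladder" and v: "v \<in> K i"
    and x: "x = poly_apply (tau t i j) A v" by auto
  have "poly_apply (tau rev_t i j) A v
      = (\<Sum>k=0..d. newton_coeff d t k *s (Psi d A E Es ^^ k) (poly_apply (tau t i j) A v))"
  proof (rule lowering_chain_series[OF chain.lin_A lin_Psi, where M = "d - i" and w = "vartheta d t"])
    show "Psi d A E Es (poly_apply (tau t i j) A v)
        = (vartheta d t j - vartheta d t i) *s poly_apply (tau t i (j - 1)) A v"
      if "i \<le> j" "j \<le> d - i" for j
      using that ij v by (intro Psi_ladder) (auto simp: ladder_def)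
    show "newton_coeff d t (Suc k) * (vartheta d t (Suc j) - vartheta d t (j - k))
        = newton_coeff d t k * (t (j - k) - t (d - j))" if "k \<le> j" "j < d" for k j
      by (rule newton_coeff_recurrence[OF rec nz that])
  qed (use ij in \<open>auto simp: ladder_def\<close>)
  then show "Delta d E Es x = (\<Sum>k=0..d. newton_coeff d t k *s (Psi d A E Es ^^ k) x)"
    using Delta_ladder[OF ij v] x by simp
qed

lemma Delta_Psi_commute: "Delta d E Es (Psi d A E Es x) = Psi d A E Es (Delta d E Es x)"
  unfolding Delta_series
  by (simp add: lin_sum[OF lin_Psi] lin_scale[OF lin_Psi] funpow_swap1)

text \<open>Being a polynomial in \<Psi>, the map \<Delta> commutes with \<Psi>; hence \<Psi> lowers the images
\<open>\<Delta> (tau t i j (A) v) = tau rev_t i j (A) v\<close> with the same factors. As \<vartheta> does not change under reversal, the expansion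
applies with the roles of the two eigenvalue orderings exchanged and recovers \<open>tau t i j (A) v\<close>.\<close>
lemma reverse_series_Delta:
  "(\<Sum>k=0..d. newton_coeff d rev_t k *s (Psi d A E Es ^^ k) (Delta d E Es x)) = x"
proof -
  let ?\<Theta> = "\<lambda>v. \<Sum>k=0..d. newton_coeff d rev_t k *s (Psi d A E Es ^^ k) v"
  have \<Theta>: "lin ?\<Theta>"
    by (rule lin_lincomb) (rule lin_funpow[OF lin_Psi])
  have "(\<lambda>x. ?\<Theta> (Delta d E Es x)) = (\<lambda>x. x)"
  proof (rule lin_eqI[OF _ _ span_ladder])
    show "lin (\<lambda>x. ?\<Theta> (Delta d E Es x))"
      by (rule linI) (simp_all only: lin_add[OF lin_Delta] lin_scale[OF lin_Delta]
          lin_add[OF \<Theta>] lin_scale[OF \<Theta>])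
    show "lin (\<lambda>x. x)" by (rule linI) simp_all
    fix x assume "x \<in> (\<Union>(i, j)\<in>ladder. poly_apply (tau t i j) A ` K i)"
    then obtain i j v where ij: "(i, j) \<in> ladder" and v: "v \<in> K i"
      and x: "x = poly_apply (tau t i j) A v" by auto
    have "poly_apply (tau t i j) A v = ?\<Theta> (poly_apply (tau rev_t i j) A v)"
    proof (rule lowering_chain_series[OF chain.lin_A lin_Psi, where M = "d - i" and w = "vartheta d rev_t"])
      fix j assume j: "i \<le> j" "j \<le> d - i"
      then have jl: "(i, j) \<in> ladder" using ij by (auto simp: ladder_def)
      have "Psi d A E Es (poly_apply (tau rev_t i j) A v)
          = (vartheta d t j - vartheta d t i) *s Delta d E Es (poly_apply (tau t i (j - 1)) A v)"
        using Delta_Psi_commute[of "poly_apply (tau t i j) A v"]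
        by (simp add: Delta_ladder[OF jl v] Psi_ladder[OF jl v] lin_scale[OF lin_Delta])
      also have "\<dots> = (vartheta d t j - vartheta d t i) *s poly_apply (tau rev_t i (j - 1)) A v"
      proof (cases "j = i")
        case False
        then have "(i, j - 1) \<in> ladder" using j ij by (auto simp: ladder_def)
        then show ?thesis by (simp add: Delta_ladder[OF _ v])
      qed simp
      finally show "Psi d A E Es (poly_apply (tau rev_t i j) A v)
          = (vartheta d rev_t j - vartheta d rev_t i) *s poly_apply (tau rev_t i (j - 1)) A v"
        using j ij by (simp add: vartheta_reverse ladder_def)
    next
      fix k j assume kj: "k \<le> j" "j < d"
      have "newton_coeff d rev_t (Suc k) * (vartheta d rev_t (Suc j) - vartheta d rev_t (j - k))
          = newton_coeff d rev_t k * (rev_t (j - k) - rev_t (d - j))"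
        by (rule newton_coeff_recurrence[OF recurrent_reverse[OF rec] _ kj])
          (simp add: vartheta_reverse nz)
      then show "newton_coeff d rev_t (Suc k) * (vartheta d rev_t (Suc j) - vartheta d rev_t (j - k))
          = newton_coeff d rev_t k * (rev_t (j - k) - t j)"
        using kj by simp
    qed (use ij in \<open>auto simp: ladder_def\<close>)
    then show "?\<Theta> (Delta d E Es x) = x"
      unfolding x Delta_ladder[OF ij v] by simp
  qed
  then show ?thesis by (rule fun_cong)
qed

lemma Delta_reverse_series:
  "Delta d E Es (\<Sum>k=0..d. newton_coeff d rev_t k *s (Psi d A E Es ^^ k) x) = x"
proof -
  have comm: "Delta d E Es ((Psi d A E Es ^^ k) x) = (Psi d A E Es ^^ k) (Delta d E Es x)" for k
    by (induction k) (simp_all add: Delta_Psi_commute)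
  show ?thesis
    using reverse_series_Delta[of x]
    by (simp add: lin_sum[OF lin_Delta] lin_scale[OF lin_Delta] comm)
qed

lemma
  shows bij_Delta: "bij (Delta d E Es)"
    and inv_Delta_series:
      "inv (Delta d E Es) = (\<lambda>v. \<Sum>k=0..d. newton_coeff d rev_t k *s (Psi d A E Es ^^ k) v)"
proof -
  have 1: "Delta d E Es \<circ> (\<lambda>v. \<Sum>k=0..d. newton_coeff d rev_t k *s (Psi d A E Es ^^ k) v) = id"
    by (simp add: fun_eq_iff Delta_reverse_series)
  have 2: "(\<lambda>v. \<Sum>k=0..d. newton_coeff d rev_t k *s (Psi d A E Es ^^ k) v) \<circ> Delta d E Es = id"
    by (simp add: fun_eq_iff reverse_series_Delta)
  show "bij (Delta d E Es)" by (rule o_bij[OF 2 1])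
  show "inv (Delta d E Es) = (\<lambda>v. \<Sum>k=0..d. newton_coeff d rev_t k *s (Psi d A E Es ^^ k) v)"
    by (rule inv_unique_comp[OF 1 2])
qed

end

end

theorem theorem17p1:
  fixes scale :: "'k::field \<Rightarrow> 'v::ab_group_add \<Rightarrow> 'v"
    and Basis :: "'v set"
    and d :: nat
    and A As :: "'v \<Rightarrow> 'v"
    and E Es :: "nat \<Rightarrow> 'v \<Rightarrow> 'v"
    and \<beta> :: 'k
  defines "\<theta> \<equiv> td_space.eigenvalue scale A E"
    and "\<theta>s \<equiv> td_space.eigenvalue scale As Es"
    and "\<Delta> \<equiv> td_space.Delta scale d E Es"
    and "\<Psi> \<equiv> td_space.Psi scale d A E Es"
  assumes "finite_dimensional_vector_space scale Basis"
    and "vector_space.dim scale (UNIV :: 'v set) > 0"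
    and "d \<ge> 1"
    and "td_space.td_system scale d A E As Es"
    and "is_base d \<theta> \<theta>s \<beta>"
    and "(\<beta> \<noteq> 2 \<and> \<beta> \<noteq> -2) \<or>
         (\<beta> = 2 \<and> CHAR('k) \<noteq> 2) \<or>
         (\<beta> = -2 \<and> CHAR('k) \<noteq> 2 \<and> even d)"
  shows "(\<forall>i\<in>{1..d}. vartheta d \<theta> i \<noteq> 0) \<and>
         bij \<Delta> \<and>
         \<Delta> = (\<lambda>v. \<Sum>k=0..d.
           scale (poly (eta d \<theta> k) (\<theta> 0) / (\<Prod>i=1..k. vartheta d \<theta> i)) ((\<Psi> ^^ k) v)) \<and>
         inv \<Delta> = (\<lambda>v. \<Sum>k=0..d.
           scale (poly (tau \<theta> 0 k) (\<theta> d) / (\<Prod>i=1..k. vartheta d \<theta> i)) ((\<Psi> ^^ k) v))"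
proof -
  interpret fd: finite_dimensional_vector_space scale Basis by fact
  interpret td: td_space scale by (intro td_space.intro fd.vector_space_axioms)
  have pair: "td.td_pair A As"
    and std: "td.standard_ordering A As d (\<lambda>i. range (E i))"
      "td.standard_ordering As A d (\<lambda>i. range (Es i))"
    using assms(8) by (auto simp: td.td_system_def)
  have lin: "td.lin A" "td.lin As" and diag: "td.diagonalizable A" "td.diagonalizable As"
    and irr: "\<not> (\<exists>W. fd.subspace W \<and> A ` W \<subseteq> W \<and> As ` W \<subseteq> W \<and> W \<noteq> {0} \<and> W \<noteq> UNIV)"
    using pair by (auto simp: td.td_pair_def)
  note chain = td.chain_of_standard_ordering[OF lin diag(1) std(1), folded \<theta>_def]
  note dual = td.chain_of_standard_ordering[OF lin(2,1) diag(2) std(2), folded \<theta>s_def]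
  interpret sys: tridiagonal_system scale Basis d A As \<theta> \<theta>s E Es
  proof (intro tridiagonal_system.intro tridiagonal_pair.intro tridiagonal_pair_axioms.intro
      tridiagonal_system_axioms.intro chain dual fd.finite_dimensional_vector_space_axioms td.td_space_axioms)
    show "W = {0} \<or> W = UNIV"
      if "fd.subspace W" "\<And>x. x \<in> W \<Longrightarrow> A x \<in> W" "\<And>x. x \<in> W \<Longrightarrow> As x \<in> W" for W
      using irr that by blast
    show "\<theta> = td.eigenvalue A E" by (simp add: \<theta>_def)
  qed
  have inj: "inj_on \<theta> {0..d}"
    using sys.chain.inj_t by (simp add: atMost_atLeast0)
  obtain \<gamma> where rec: "recurrent \<beta> \<gamma> d \<theta>"
    using recurrent_of_base[OF assms(9) inj] by blast
  \<comment> \<open>The three cases on \<beta> enter only through this consequence. In the second one, \<open>2 = -2\<close> would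
    force characteristic 2.\<close>
  have "even d \<or> \<beta> \<noteq> -2"
  proof (rule ccontr)
    assume neg: "\<not> (even d \<or> \<beta> \<noteq> -2)"
    then have "(2 :: 'k) = - 2" and char: "CHAR('k) \<noteq> 2"
      using assms(10) by auto
    then have "(2 :: 'k) * 2 = 0"
      by (metis add_eq_0_iff2 mult_2)
    then have "(2 :: 'k) = 0" by (simp only: mult_eq_0_iff simp_thms)
    then have "of_nat 2 = (0 :: 'k)" by simp
    then have "CHAR('k) dvd 2"
      by (simp only: of_nat_eq_0_iff_char_dvd)
    then show False
      using char CHAR_not_1 two_is_prime_nat by (auto simp: prime_nat_iff)
  qed
  then have nz: "vartheta d \<theta> i \<noteq> 0" if "1 \<le> i" "i \<le> d" for i
    using vartheta_nonzero[OF rec inj _ that] by blast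
  have "(\<Sum>k=0..d. scale (newton_coeff d sys.rev_t k) ((\<Psi> ^^ k) v))
      = (\<Sum>k=0..d. scale (poly (tau \<theta> 0 k) (\<theta> d) / (\<Prod>i=1..k. vartheta d \<theta> i)) ((\<Psi> ^^ k) v))" for v
    by (intro sum.cong) (simp_all add: newton_coeff_reverse_eq_tau)
  then show ?thesis
    using nz sys.bij_Delta[OF rec nz] sys.Delta_series[OF rec nz] sys.inv_Delta_series[OF rec nz]
    by (simp add: newton_coeff_eq_eta \<Delta>_def \<Psi>_def)
qed

end
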